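(* Let $X$ be a limit space and let $\mathcal{O}$ be a convergence system for $X$ which is closed under finite intersections. Consider $\mathcal{O}$ as a small category whose morphisms are the inclusions $U\subseteq V$ between members of $\mathcal{O}$, each $U\in\mathcal{O}$ being regarded as a limit space with the subspace convergence inherited from $X$. Then restricting the fundamental groupoid functor $\Pi$ to $\mathcal{O}$ defines a diagram $\Pi|_{\mathcal{O}}\colon\mathcal{O}\to\mathrm{Groupoid}$ such that $$\Pi(X)=\operatorname{colim}(\Pi|_{\mathcal{O}}),$$ i.e. the functors $\Pi(U)\to\Pi(X)$ induced by the inclusions $U\hookrightarrow X$ ($U\in\mathcal{O}$) form a colimit cocone for $\Pi|_{\mathcal{O}}$ in the category of (small) groupoids.
   Context: **Nets.** A net in a set $X$ is a function $\varphi\colon\mathbb{D}\to X$ with $\mathbb{D}$ a (nonempty) directed preordered set. Its tail sets are $\varphi[a^\uparrow]=\{\varphi(b):b\succeq a\}$, $a\in\mathbb{D}$, and $\varphi^\uparrow$ denotes the proper filter of all subsets of $X$ containing a tail set of $\varphi$. Every proper filter on $X$ is of the form $\varphi^\uparrow$. A net $\psi$ is a subnet of $\varphi$ if $\varphi^\uparrow\subseteq\psi^\uparrow$. **Limit spaces.** A preconvergence on $X$ is an assignment $L$ of a subset $L(\varphi)\subseteq X$ to each net $\varphi$ in $X$ such that $L(\varphi)=L(\psi)$ whenever $\varphi^\uparrow=\psi^\uparrow$ (equivalently, a function from proper filters on $X$ to subsets of $X$). One writes $\varphi\to_L x$ for $x\in L(\varphi)$. A limit space is a set $X$ with a preconvergence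 $L$ that is: centered (every constant net with value $x$ converges to $x$); isotone (if $\varphi^\uparrow\subseteq\psi^\uparrow$ then $L(\varphi)\subseteq L(\psi)$); and stable: $L(\varphi)\cap L(\psi)\subseteq L(\rho)$ whenever $\varphi,\psi,\rho\colon\mathbb{D}\to X$ are nets and there is $D\in\mathbb{D}$ with $\rho(d)\in\{\varphi(d),\psi(d)\}$ for all $d\succeq D$. (For isotone $L$, stability is equivalent to: $L(\mathcal{F})\cap L(\mathcal{G})\subseteq L(\mathcal{F}\cap\mathcal{G})$ for all proper filters $\mathcal{F},\mathcal{G}$.) A function $f\colon X\to Y$ between limit spaces is continuous if $\varphi\to x$ in $X$ implies $f\circ\varphi\to f(x)$ in $Y$. $C(X,Y)$ is the set of continuous functions. A topological space is a limit space via its usual net convergence. A subset $U\subseteq X$ carries the subspace convergence: a net $\psi$ in $U$ converges to $x\in U$ in $U$ iff $\psi\to x$ in $X$; it makes $U$ a limit space. **Continuous convergence.** For limit spaces $X,Y$, the set $C(X,Y)$ is a limit space under continuous convergence: $(f_d)_d\to_c f$ iff for every $x\in X$ and every net $(x_a)_a$ in $X$ with $x_a\to x$, the net $(f_d(x_a))_{d,a}$ (indexed by the product directed set) converges to $f(x)$ in $Y$. **Convergence systems.** A family $\mathcal{C}$ of subsets of $X$ is a convergence system for $X$ if for every $x\in X$ and every net $\varphi$ in $X$ with $\varphi\to x$ there is $C\in\mathcal{C}$ with $C\in\varphi^\uparrow$ (i.e. $C$ contains a tail set of $\varphi$). "Closed under finite intersections" refers to intersections of nonempty finite subfamilies. **Fundamental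 groupoid.** Let $I=[0,1]$ with its usual topological convergence. A path in $X$ from $x$ to $y$ is a continuous $\gamma\colon I\to X$ with $\gamma(0)=x$, $\gamma(1)=y$. Two paths $\gamma,\gamma'$ from $x$ to $y$ are rel-homotopic if there is a path $H\colon I\to C(I,X)$ (with continuous convergence on $C(I,X)$) from $\gamma$ to $\gamma'$ such that $H(t)$ is a path from $x$ to $y$ for every $t\in I$; this is an equivalence relation. The fundamental groupoid $\Pi(X)$ has the points of $X$ as objects and rel-homotopy classes $[\gamma]$ of paths from $x$ to $y$ as arrows $x\to y$; composition is $[\rho]\circ[\gamma]=[\gamma*\rho]$, where $(\gamma*\rho)(t)=\gamma(2t)$ for $t\le 1/2$ and $\rho(2t-1)$ for $t\ge 1/2$; identities are classes of constant paths. This is a groupoid, and $\Pi$ is a functor from limit spaces and continuous maps to groupoids, sending $f\colon X\to Y$ to the functor that acts as $f$ on objects and as $[\gamma]\mapsto[f\circ\gamma]$ on arrows. *)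

theory Defs
  imports "HOL-Analysis.Analysis"
begin

section \<open>Limit spaces\<close>

text \<open>
  A preconvergence is a function from the proper filters on the carrier to subsets of the carrier.
  A filter on a subset \<^term>\<open>S\<close> of a type \<^typ>\<open>'a\<close> is an Isabelle filter on \<^typ>\<open>'a\<close> below
  \<^term>\<open>principal S\<close>. The order on Isabelle filters is reverse inclusion: \<^term>\<open>G \<le> F\<close> says that every
  member of \<^term>\<open>F\<close> is a member of \<^term>\<open>G\<close>, so \<^term>\<open>sup F G\<close> is the intersection of the two
  families of sets, and \<^term>\<open>bot\<close> is the improper filter. The values of \<^term>\<open>limits X\<close> on
  filters that are not proper filters on the carrier are irrelevant.
\<close>

record 'a convergence_space =
  points :: "'a set"
  limits :: "'a filter \<Rightarrow> 'a set"

definition proper_filter_on :: "'a set \<Rightarrow> 'a filter \<Rightarrow> bool" where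
  "proper_filter_on S F \<longleftrightarrow> F \<noteq> bot \<and> F \<le> principal S"

definition preconvergence :: "'a convergence_space \<Rightarrow> bool" where
  "preconvergence X \<longleftrightarrow> (\<forall>F. proper_filter_on (points X) F \<longrightarrow> limits X F \<subseteq> points X)"

definition centered :: "'a convergence_space \<Rightarrow> bool" where
  "centered X \<longleftrightarrow> (\<forall>x\<in>points X. x \<in> limits X (principal {x}))"

definition isotone :: "'a convergence_space \<Rightarrow> bool" where
  "isotone X \<longleftrightarrow> (\<forall>F G. proper_filter_on (points X) F \<longrightarrow> proper_filter_on (points X) G \<longrightarrow>
     G \<le> F \<longrightarrow> limits X F \<subseteq> limits X G)"

definition stable :: "'a convergence_space \<Rightarrow> bool" where
  "stable X \<longleftrightarrow> (\<forall>F G. proper_filter_on (points X) F \<longrightarrow> proper_filter_on (points X) G \<longrightarrow>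
     limits X F \<inter> limits X G \<subseteq> limits X (sup F G))"

definition limit_space :: "'a convergence_space \<Rightarrow> bool" where
  "limit_space X \<longleftrightarrow> preconvergence X \<and> centered X \<and> isotone X \<and> stable X"

definition topological_space_conv :: "'a topology \<Rightarrow> 'a convergence_space" where
  "topological_space_conv T =
     \<lparr>points = topspace T, limits = (\<lambda>F. {x \<in> topspace T. F \<le> nhdsin T x})\<rparr>"

definition subspace_conv :: "'a convergence_space \<Rightarrow> 'a set \<Rightarrow> 'a convergence_space" where
  "subspace_conv X U = \<lparr>points = U, limits = (\<lambda>F. limits X F \<inter> U)\<rparr>"

text \<open>
  Functions with domain \<^term>\<open>points X\<close> are represented by HOL functions that are extensional on
  \<^term>\<open>points X\<close>, so that equality of functions is equality on the domain.
\<close>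

definition continuous_functions ::
    "'a convergence_space \<Rightarrow> 'b convergence_space \<Rightarrow> ('a \<Rightarrow> 'b) set" where
  "continuous_functions X Y =
     {f \<in> points X \<rightarrow>\<^sub>E points Y.
        \<forall>F x. proper_filter_on (points X) F \<longrightarrow> x \<in> limits X F \<longrightarrow> f x \<in> limits Y (filtermap f F)}"

definition continuous_convergence ::
    "'a convergence_space \<Rightarrow> 'b convergence_space \<Rightarrow> ('a \<Rightarrow> 'b) convergence_space" where
  "continuous_convergence X Y =
     \<lparr>points = continuous_functions X Y,
      limits = (\<lambda>F. {f \<in> continuous_functions X Y.
        \<forall>G x. proper_filter_on (points X) G \<longrightarrow> x \<in> limits X G \<longrightarrow>
          f x \<in> limits Y (filtermap (\<lambda>(g, a). g a) (F \<times>\<^sub>F G))})\<rparr>"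

definition convergence_system :: "'a convergence_space \<Rightarrow> 'a set set \<Rightarrow> bool" where
  "convergence_system X \<C> \<longleftrightarrow> (\<forall>C\<in>\<C>. C \<subseteq> points X) \<and>
     (\<forall>F. proper_filter_on (points X) F \<longrightarrow> (\<forall>x\<in>limits X F. \<exists>C\<in>\<C>. eventually (\<lambda>y. y \<in> C) F))"

definition closed_under_finite_intersections :: "'a set set \<Rightarrow> bool" where
  "closed_under_finite_intersections \<C> \<longleftrightarrow>
     (\<forall>\<F>. \<F> \<subseteq> \<C> \<longrightarrow> finite \<F> \<longrightarrow> \<F> \<noteq> {} \<longrightarrow> \<Inter>\<F> \<in> \<C>)"


subsection \<open>Nets and filters\<close>

text \<open>
  The lemmas of this subsection relate the definitions above to nets: the tail filters of nets in
  a set are exactly the proper filters on it, images of nets and product nets correspond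
  to \<^const>\<open>filtermap\<close> and \<^const>\<open>prod_filter\<close>, and \<^const>\<open>stable\<close> is stability for nets.
\<close>

definition directed_preorder :: "'d set \<Rightarrow> ('d \<Rightarrow> 'd \<Rightarrow> bool) \<Rightarrow> bool" where
  "directed_preorder D le \<longleftrightarrow> D \<noteq> {} \<and> (\<forall>a\<in>D. le a a) \<and>
     (\<forall>a\<in>D. \<forall>b\<in>D. \<forall>c\<in>D. le a b \<longrightarrow> le b c \<longrightarrow> le a c) \<and>
     (\<forall>a\<in>D. \<forall>b\<in>D. \<exists>c\<in>D. le a c \<and> le b c)"

lemma directed_preorderD:
  assumes "directed_preorder D le"
  shows "\<exists>a. a \<in> D" and "\<And>a. a \<in> D \<Longrightarrow> le a a"
    and "\<And>a b c. a \<in> D \<Longrightarrow> b \<in> D \<Longrightarrow> c \<in> D \<Longrightarrow> le a b \<Longrightarrow> le b c \<Longrightarrow> le a c"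
    and "\<And>a b. a \<in> D \<Longrightarrow> b \<in> D \<Longrightarrow> \<exists>c\<in>D. le a c \<and> le b c"
  using assms unfolding directed_preorder_def by (blast, blast, blast, blast)

definition net_filter :: "'d set \<Rightarrow> ('d \<Rightarrow> 'd \<Rightarrow> bool) \<Rightarrow> ('d \<Rightarrow> 'a) \<Rightarrow> 'a filter" where
  "net_filter D le \<phi> = (INF a\<in>D. principal (\<phi> ` {b \<in> D. le a b}))"

lemma eventually_net_filter:
  assumes "directed_preorder D le"
  shows "eventually P (net_filter D le \<phi>) \<longleftrightarrow> (\<exists>a\<in>D. \<forall>b\<in>D. le a b \<longrightarrow> P (\<phi> b))"
proof -
  have "eventually P (net_filter D le \<phi>) \<longleftrightarrow>
      (\<exists>a\<in>D. eventually P (principal (\<phi> ` {b \<in> D. le a b})))"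
    unfolding net_filter_def
  proof (rule eventually_INF_base)
    show "D \<noteq> {}" using assms by (simp add: directed_preorder_def)
    fix a b assume ab: "a \<in> D" "b \<in> D"
    then obtain c where c: "c \<in> D" "le a c" "le b c"
      using assms unfolding directed_preorder_def by meson
    have "{d \<in> D. le c d} \<subseteq> {d \<in> D. le a d} \<inter> {d \<in> D. le b d}"
      using assms ab c unfolding directed_preorder_def by blast
    then show "\<exists>x\<in>D. principal (\<phi> ` {b \<in> D. le x b}) \<le>
        inf (principal (\<phi> ` {b \<in> D. le a b})) (principal (\<phi> ` {d \<in> D. le b d}))"
      using c(1) by (intro bexI[of _ c]) auto
  qed
  then show ?thesis by (auto simp: eventually_principal)
qed

lemma proper_net_filter:
  assumes "directed_preorder D le" and "\<phi> \<in> D \<rightarrow> S"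
  shows "proper_filter_on S (net_filter D le \<phi>)"
proof -
  have "\<not> eventually (\<lambda>_. False) (net_filter D le \<phi>)"
    unfolding eventually_net_filter[OF assms(1)] using directed_preorderD(2)[OF assms(1)] by blast
  moreover have "eventually (\<lambda>x. x \<in> S) (net_filter D le \<phi>)"
    unfolding eventually_net_filter[OF assms(1)]
    using directed_preorderD(1)[OF assms(1)] assms(2) by blast
  ultimately show ?thesis
    by (auto simp: proper_filter_on_def le_principal)
qed

lemma proper_filter_is_net_filter:
  fixes F :: "'a filter"
  assumes "proper_filter_on S F"
  obtains D :: "('a \<times> 'a set) set" and le \<phi>
  where "directed_preorder D le" "\<phi> \<in> D \<rightarrow> S" "net_filter D le \<phi> = F"
proof -
  define D where "D = {(a, A). a \<in> A \<and> A \<subseteq> S \<and> eventually (\<lambda>x. x \<in> A) F}"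
  define le where "le = (\<lambda>(p :: 'a \<times> 'a set) (q :: 'a \<times> 'a set). snd q \<subseteq> snd p)"
  have ne: "\<exists>a. a \<in> A" if "eventually (\<lambda>x. x \<in> A) F" for A
    using assms that eventually_False[of F] unfolding proper_filter_on_def
    by (metis (mono_tags, lifting) eventually_mono)
  have S: "eventually (\<lambda>x. x \<in> S) F"
    using assms by (simp add: proper_filter_on_def le_principal)
  have dir: "directed_preorder D le"
    unfolding directed_preorder_def
  proof (intro conjI ballI)
    show "D \<noteq> {}" using ne[OF S] S by (auto simp: D_def)
    fix p q assume "p \<in> D" "q \<in> D"
    then have ev: "eventually (\<lambda>x. x \<in> snd p \<inter> snd q) F" and "snd p \<inter> snd q \<subseteq> S"
      by (auto simp: D_def eventually_conj_iff)
    moreover obtain c where "c \<in> snd p \<inter> snd q" using ne[OF ev] by blast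
    ultimately show "\<exists>r\<in>D. le p r \<and> le q r"
      by (intro bexI[of _ "(c, snd p \<inter> snd q)"]) (auto simp: D_def le_def)
  qed (auto simp: le_def)
  have "eventually P (net_filter D le fst) \<longleftrightarrow> eventually P F" for P
  proof
    assume "eventually P (net_filter D le fst)"
    then obtain p where p: "p \<in> D" "\<And>q. q \<in> D \<Longrightarrow> le p q \<Longrightarrow> P (fst q)"
      by (auto simp: eventually_net_filter[OF dir])
    have "P b" if "b \<in> snd p" for b
      using p(1) p(2)[of "(b, snd p)"] that by (auto simp: D_def le_def)
    then show "eventually P F"
      using p(1) by (auto simp: D_def elim!: eventually_mono)
  next
    assume P: "eventually P F"
    have ev: "eventually (\<lambda>x. x \<in> {x \<in> S. P x}) F"
      using P S by (simp add: eventually_conj_iff)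
    obtain a where "a \<in> {x \<in> S. P x}" using ne[OF ev] by blast
    then show "eventually P (net_filter D le fst)"
      unfolding eventually_net_filter[OF dir]
      using ev by (intro bexI[of _ "(a, {x \<in> S. P x})"]) (auto simp: D_def le_def)
  qed
  then have "net_filter D le fst = F" by (simp add: filter_eq_iff)
  then show thesis using dir by (intro that[of D le fst]) (auto simp: D_def)
qed

lemma net_filter_compose:
  assumes "directed_preorder D le"
  shows "net_filter D le (f \<circ> \<phi>) = filtermap f (net_filter D le \<phi>)"
  using assms by (simp add: filter_eq_iff eventually_filtermap eventually_net_filter)

lemma net_filter_product:
  assumes D: "directed_preorder D le" and E: "directed_preorder E le'"
  shows "net_filter (D \<times> E) (\<lambda>(d, e) (d', e'). le d d' \<and> le' e e') (\<lambda>(d, e). (f d) (x e)) =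
    filtermap (\<lambda>(g, a). g a) (net_filter D le f \<times>\<^sub>F net_filter E le' x)"
proof -
  have DE: "directed_preorder (D \<times> E) (\<lambda>(d, e) (d', e'). le d d' \<and> le' e e')"
    unfolding directed_preorder_def
  proof (intro conjI ballI)
    show "D \<times> E \<noteq> {}" using directed_preorderD(1)[OF D] directed_preorderD(1)[OF E] by blast
    fix p q assume "p \<in> D \<times> E" "q \<in> D \<times> E"
    then have pq: "fst p \<in> D" "fst q \<in> D" "snd p \<in> E" "snd q \<in> E" by auto
    obtain c where "c \<in> D" "le (fst p) c" "le (fst q) c"
      using D pq(1,2) unfolding directed_preorder_def by meson
    moreover obtain c' where "c' \<in> E" "le' (snd p) c'" "le' (snd q) c'"
      using E pq(3,4) unfolding directed_preorder_def by meson
    ultimately show "\<exists>r\<in>D \<times> E. (case p of (d, e) \<Rightarrow> \<lambda>(d', e'). le d d' \<and> le' e e') r \<and>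
        (case q of (d, e) \<Rightarrow> \<lambda>(d', e'). le d d' \<and> le' e e') r"
      by (intro bexI[of _ "(c, c')"]) (auto simp: split_beta)
  next
    fix p q r assume "p \<in> D \<times> E" "q \<in> D \<times> E" "r \<in> D \<times> E"
    then show "(case p of (d, e) \<Rightarrow> \<lambda>(d', e'). le d d' \<and> le' e e') q \<longrightarrow>
        (case q of (d, e) \<Rightarrow> \<lambda>(d', e'). le d d' \<and> le' e e') r \<longrightarrow>
        (case p of (d, e) \<Rightarrow> \<lambda>(d', e'). le d d' \<and> le' e e') r"
      using directed_preorderD(3)[OF D, of "fst p" "fst q" "fst r"]
        directed_preorderD(3)[OF E, of "snd p" "snd q" "snd r"]
      by (simp add: split_beta mem_Times_iff)
  next
    fix p assume "p \<in> D \<times> E"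
    then show "(case p of (d, e) \<Rightarrow> \<lambda>(d', e'). le d d' \<and> le' e e') p"
      using directed_preorderD(2)[OF D] directed_preorderD(2)[OF E] by auto
  qed
  show ?thesis
    unfolding filter_eq_iff
  proof
    fix P
    let ?L = "eventually P (net_filter (D \<times> E) (\<lambda>(d, e) (d', e'). le d d' \<and> le' e e')
        (\<lambda>(d, e). f d (x e)))"
    let ?R = "eventually P (filtermap (\<lambda>(g, a). g a) (net_filter D le f \<times>\<^sub>F net_filter E le' x))"
    have "?L \<longleftrightarrow> (\<exists>a\<in>D. \<exists>b\<in>E. \<forall>d\<in>D. \<forall>e\<in>E. le a d \<and> le' b e \<longrightarrow> P (f d (x e)))"
      unfolding eventually_net_filter[OF DE] by simp
    also have "\<dots> \<longleftrightarrow> ?R"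
    proof
      assume "\<exists>a\<in>D. \<exists>b\<in>E. \<forall>d\<in>D. \<forall>e\<in>E. le a d \<and> le' b e \<longrightarrow> P (f d (x e))"
      then obtain a b where ab: "a \<in> D" "b \<in> E"
        "\<forall>d\<in>D. \<forall>e\<in>E. le a d \<and> le' b e \<longrightarrow> P (f d (x e))" by blast
      have "eventually (\<lambda>g. g \<in> f ` {d \<in> D. le a d}) (net_filter D le f)"
        "eventually (\<lambda>y. y \<in> x ` {e \<in> E. le' b e}) (net_filter E le' x)"
        unfolding eventually_net_filter[OF D] eventually_net_filter[OF E] using ab(1,2) by blast+
      moreover have "P (g y)" if "g \<in> f ` {d \<in> D. le a d}" "y \<in> x ` {e \<in> E. le' b e}" for g y
        using that ab(3) by blast
      ultimately show ?R
        unfolding eventually_filtermap eventually_prod_filter by force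
    next
      assume ?R
      then obtain Q Q' where Q: "eventually Q (net_filter D le f)"
        "eventually Q' (net_filter E le' x)" "\<And>g a. Q g \<Longrightarrow> Q' a \<Longrightarrow> P (g a)"
        by (auto simp: eventually_filtermap eventually_prod_filter)
      then show "\<exists>a\<in>D. \<exists>b\<in>E. \<forall>d\<in>D. \<forall>e\<in>E. le a d \<and> le' b e \<longrightarrow> P (f d (x e))"
        unfolding eventually_net_filter[OF D] eventually_net_filter[OF E] by blast
    qed
    finally show "?L \<longleftrightarrow> ?R" .
  qed
qed

definition net_stable :: "'d itself \<Rightarrow> 'a convergence_space \<Rightarrow> bool" where
  "net_stable _ X \<longleftrightarrow> (\<forall>(D :: 'd set) le \<phi> \<psi> \<rho>. directed_preorder D le \<longrightarrow>
     \<phi> \<in> D \<rightarrow> points X \<longrightarrow> \<psi> \<in> D \<rightarrow> points X \<longrightarrow> \<rho> \<in> D \<rightarrow> points X \<longrightarrow>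
     (\<exists>a\<in>D. \<forall>d\<in>D. le a d \<longrightarrow> \<rho> d \<in> {\<phi> d, \<psi> d}) \<longrightarrow>
     limits X (net_filter D le \<phi>) \<inter> limits X (net_filter D le \<psi>) \<subseteq> limits X (net_filter D le \<rho>))"

lemma proper_filter_on_sup:
  assumes "proper_filter_on S F" "proper_filter_on S G"
  shows "proper_filter_on S (sup F G)"
  using assms by (auto simp: proper_filter_on_def sup_eq_bot_iff)

lemma stable_imp_net_stable:
  assumes "isotone X" and "stable X"
  shows "net_stable TYPE('d) X"
  unfolding net_stable_def
proof (intro allI impI)
  fix D :: "'d set" and le \<phi> \<psi> \<rho>
  assume D: "directed_preorder D le"
    and nets: "\<phi> \<in> D \<rightarrow> points X" "\<psi> \<in> D \<rightarrow> points X" "\<rho> \<in> D \<rightarrow> points X"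
    and "\<exists>a\<in>D. \<forall>d\<in>D. le a d \<longrightarrow> \<rho> d \<in> {\<phi> d, \<psi> d}"
  then obtain a where a: "a \<in> D" "\<And>d. d \<in> D \<Longrightarrow> le a d \<Longrightarrow> \<rho> d = \<phi> d \<or> \<rho> d = \<psi> d" by blast
  let ?F = "net_filter D le"
  have "?F \<rho> \<le> sup (?F \<phi>) (?F \<psi>)"
    unfolding le_filter_def
  proof (intro allI impI)
    fix P assume "eventually P (sup (?F \<phi>) (?F \<psi>))"
    then obtain b c where bc: "b \<in> D" "\<And>d. d \<in> D \<Longrightarrow> le b d \<Longrightarrow> P (\<phi> d)"
        "c \<in> D" "\<And>d. d \<in> D \<Longrightarrow> le c d \<Longrightarrow> P (\<psi> d)"
      by (auto simp: eventually_sup eventually_net_filter[OF D])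
    obtain u where u: "u \<in> D" "le a u" "le b u"
      using directed_preorderD(4)[OF D a(1) bc(1)] by blast
    obtain v where v: "v \<in> D" "le u v" "le c v"
      using directed_preorderD(4)[OF D u(1) bc(3)] by blast
    have "P (\<rho> d)" if "d \<in> D" "le v d" for d
    proof -
      have d: "le u d" "le c d"
        using directed_preorderD(3)[OF D] that u(1) v bc(3) by blast+
      then have "le a d" "le b d"
        using directed_preorderD(3)[OF D] that(1) u a(1) bc(1) by blast+
      then show ?thesis using a(2)[OF that(1)] bc(2,4)[OF that(1)] d(2) by auto
    qed
    then show "eventually P (?F \<rho>)" using v(1) by (auto simp: eventually_net_filter[OF D])
  qed
  then have "limits X (sup (?F \<phi>) (?F \<psi>)) \<subseteq> limits X (?F \<rho>)"
    using assms(1) nets proper_net_filter[OF D] proper_filter_on_sup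
    unfolding isotone_def by metis
  moreover have "limits X (?F \<phi>) \<inter> limits X (?F \<psi>) \<subseteq> limits X (sup (?F \<phi>) (?F \<psi>))"
    using assms(2) nets proper_net_filter[OF D] unfolding stable_def by metis
  ultimately show "limits X (?F \<phi>) \<inter> limits X (?F \<psi>) \<subseteq> limits X (?F \<rho>)" by blast
qed

lemma net_stable_imp_stable:
  fixes X :: "'a convergence_space"
  assumes "net_stable TYPE((('a \<times> 'a set) \<times> ('a \<times> 'a set)) \<times> bool) X"
  shows "stable X"
  unfolding stable_def
proof (intro allI impI)
  fix F G assume F: "proper_filter_on (points X) F" and G: "proper_filter_on (points X) G"
  obtain D :: "('a \<times> 'a set) set" and le \<phi>
    where D: "directed_preorder D le" "\<phi> \<in> D \<rightarrow> points X" "net_filter D le \<phi> = F"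
    using proper_filter_is_net_filter[OF F] .
  obtain E :: "('a \<times> 'a set) set" and le' \<psi>
    where E: "directed_preorder E le'" "\<psi> \<in> E \<rightarrow> points X" "net_filter E le' \<psi> = G"
    using proper_filter_is_net_filter[OF G] .
  define K where "K = (D \<times> E) \<times> (UNIV :: bool set)"
  define le2 where "le2 = (\<lambda>(p :: (('a \<times> 'a set) \<times> ('a \<times> 'a set)) \<times> bool) (q :: _ \<times> bool).
    le (fst (fst p)) (fst (fst q)) \<and> le' (snd (fst p)) (snd (fst q)))"
  have K: "directed_preorder K le2"
    unfolding directed_preorder_def
  proof (intro conjI ballI)
    show "K \<noteq> {}" using directed_preorderD(1)[OF D(1)] directed_preorderD(1)[OF E(1)] by (auto simp: K_def)
    show "le2 p p" if "p \<in> K" for p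
      using that directed_preorderD(2)[OF D(1)] directed_preorderD(2)[OF E(1)]
      by (auto simp: K_def le2_def)
    show "le2 p q \<longrightarrow> le2 q r \<longrightarrow> le2 p r" if "p \<in> K" "q \<in> K" "r \<in> K" for p q r
      using that directed_preorderD(3)[OF D(1), of "fst (fst p)" "fst (fst q)" "fst (fst r)"]
        directed_preorderD(3)[OF E(1), of "snd (fst p)" "snd (fst q)" "snd (fst r)"]
      by (simp add: K_def le2_def mem_Times_iff)
    fix p q assume "p \<in> K" "q \<in> K"
    then have pq: "fst (fst p) \<in> D" "fst (fst q) \<in> D" "snd (fst p) \<in> E" "snd (fst q) \<in> E"
      by (auto simp: K_def)
    obtain c where "c \<in> D" "le (fst (fst p)) c" "le (fst (fst q)) c"
      using D(1) pq(1,2) unfolding directed_preorder_def by meson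
    moreover obtain c' where "c' \<in> E" "le' (snd (fst p)) c'" "le' (snd (fst q)) c'"
      using E(1) pq(3,4) unfolding directed_preorder_def by meson
    ultimately show "\<exists>r\<in>K. le2 p r \<and> le2 q r"
      by (intro bexI[of _ "((c, c'), True)"]) (auto simp: K_def le2_def)
  qed
  define \<phi>' \<psi>' :: "(('a \<times> 'a set) \<times> ('a \<times> 'a set)) \<times> bool \<Rightarrow> 'a"
    where "\<phi>' = (\<lambda>p. \<phi> (fst (fst p)))" and "\<psi>' = (\<lambda>p. \<psi> (snd (fst p)))"
  define \<rho> where "\<rho> = (\<lambda>p. if snd p then \<phi>' p else \<psi>' p)"
  have evK: "eventually P (net_filter K le2 \<xi>) \<longleftrightarrow>
      (\<exists>a\<in>D. \<exists>b\<in>E. \<forall>d\<in>D. \<forall>e\<in>E. le a d \<and> le' b e \<longrightarrow>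
        P (\<xi> ((d, e), True)) \<and> P (\<xi> ((d, e), False)))"
    for P and \<xi> :: "_ \<Rightarrow> 'a"
    unfolding eventually_net_filter[OF K]
    by (simp add: K_def le2_def all_bool_eq)
  obtain a0 b0 where DE: "a0 \<in> D" "b0 \<in> E"
    using directed_preorderD(1)[OF D(1)] directed_preorderD(1)[OF E(1)] by blast
  note refl = directed_preorderD(2)[OF D(1)] directed_preorderD(2)[OF E(1)]
  have 1: "net_filter K le2 \<phi>' = F"
    unfolding D(3)[symmetric] filter_eq_iff evK eventually_net_filter[OF D(1)] \<phi>'_def
    using DE refl by simp blast
  have 2: "net_filter K le2 \<psi>' = G"
    unfolding E(3)[symmetric] filter_eq_iff evK eventually_net_filter[OF E(1)] \<psi>'_def
    using DE refl by simp blast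
  have 3: "net_filter K le2 \<rho> = sup F G"
    unfolding D(3)[symmetric] E(3)[symmetric] filter_eq_iff evK eventually_sup
      eventually_net_filter[OF D(1)] eventually_net_filter[OF E(1)]
    using DE refl by (simp add: \<rho>_def \<phi>'_def \<psi>'_def all_bool_eq) blast
  have "\<phi>' \<in> K \<rightarrow> points X" "\<psi>' \<in> K \<rightarrow> points X" "\<rho> \<in> K \<rightarrow> points X"
    using D(2) E(2) by (auto simp: K_def \<rho>_def \<phi>'_def \<psi>'_def)
  moreover have "\<exists>a\<in>K. \<forall>d\<in>K. le2 a d \<longrightarrow> \<rho> d \<in> {\<phi>' d, \<psi>' d}"
    using directed_preorderD(1)[OF K] by (auto simp: \<rho>_def)
  ultimately have "limits X (net_filter K le2 \<phi>') \<inter> limits X (net_filter K le2 \<psi>')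
      \<subseteq> limits X (net_filter K le2 \<rho>)"
    using assms[unfolded net_stable_def, rule_format, OF K, of \<phi>' \<psi>' \<rho>] by blast
  then show "limits X F \<inter> limits X G \<subseteq> limits X (sup F G)"
    unfolding 1 2 3 .
qed


section \<open>Small categories, groupoids and colimits of groupoids\<close>

text \<open>\<open>Comp C g f\<close> is the composite of \<open>f\<close> followed by \<open>g\<close>.\<close>

record ('o, 'm) cat =
  Obj :: "'o set"
  Arr :: "'m set"
  Dom :: "'m \<Rightarrow> 'o"
  Cod :: "'m \<Rightarrow> 'o"
  Ident :: "'o \<Rightarrow> 'm"
  Comp :: "'m \<Rightarrow> 'm \<Rightarrow> 'm"

definition category :: "('o, 'm) cat \<Rightarrow> bool" where
  "category C \<longleftrightarrow>
     (\<forall>f\<in>Arr C. Dom C f \<in> Obj C \<and> Cod C f \<in> Obj C) \<and>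
     (\<forall>x\<in>Obj C. Ident C x \<in> Arr C \<and> Dom C (Ident C x) = x \<and> Cod C (Ident C x) = x) \<and>
     (\<forall>f\<in>Arr C. \<forall>g\<in>Arr C. Dom C g = Cod C f \<longrightarrow>
        Comp C g f \<in> Arr C \<and> Dom C (Comp C g f) = Dom C f \<and> Cod C (Comp C g f) = Cod C g) \<and>
     (\<forall>f\<in>Arr C. Comp C f (Ident C (Dom C f)) = f \<and> Comp C (Ident C (Cod C f)) f = f) \<and>
     (\<forall>f\<in>Arr C. \<forall>g\<in>Arr C. \<forall>h\<in>Arr C. Dom C g = Cod C f \<longrightarrow> Dom C h = Cod C g \<longrightarrow>
        Comp C h (Comp C g f) = Comp C (Comp C h g) f)"

definition groupoid :: "('o, 'm) cat \<Rightarrow> bool" where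
  "groupoid C \<longleftrightarrow> category C \<and>
     (\<forall>f\<in>Arr C. \<exists>g\<in>Arr C. Dom C g = Cod C f \<and> Cod C g = Dom C f \<and>
        Comp C g f = Ident C (Dom C f) \<and> Comp C f g = Ident C (Cod C f))"

record ('o, 'm, 'p, 'n) functor_maps =
  on_obj :: "'o \<Rightarrow> 'p"
  on_arr :: "'m \<Rightarrow> 'n"

text \<open>
  Both maps of a functor are extensional, so that equality of functors is HOL equality.
\<close>

definition is_functor ::
    "('o, 'm) cat \<Rightarrow> ('p, 'n) cat \<Rightarrow> ('o, 'm, 'p, 'n) functor_maps \<Rightarrow> bool" where
  "is_functor C D F \<longleftrightarrow>
     on_obj F \<in> Obj C \<rightarrow>\<^sub>E Obj D \<and> on_arr F \<in> Arr C \<rightarrow>\<^sub>E Arr D \<and>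
     (\<forall>f\<in>Arr C. Dom D (on_arr F f) = on_obj F (Dom C f) \<and>
        Cod D (on_arr F f) = on_obj F (Cod C f)) \<and>
     (\<forall>x\<in>Obj C. on_arr F (Ident C x) = Ident D (on_obj F x)) \<and>
     (\<forall>f\<in>Arr C. \<forall>g\<in>Arr C. Dom C g = Cod C f \<longrightarrow>
        on_arr F (Comp C g f) = Comp D (on_arr F g) (on_arr F f))"

definition identity_functor :: "('o, 'm) cat \<Rightarrow> ('o, 'm, 'o, 'm) functor_maps" where
  "identity_functor C = \<lparr>on_obj = (\<lambda>x\<in>Obj C. x), on_arr = (\<lambda>f\<in>Arr C. f)\<rparr>"

definition compose_functors ::
    "('o, 'm) cat \<Rightarrow> ('p, 'n, 'q, 'r) functor_maps \<Rightarrow> ('o, 'm, 'p, 'n) functor_maps \<Rightarrow>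
     ('o, 'm, 'q, 'r) functor_maps" where
  "compose_functors C G F =
     \<lparr>on_obj = compose (Obj C) (on_obj G) (on_obj F),
      on_arr = compose (Arr C) (on_arr G) (on_arr F)\<rparr>"

definition inclusion_category :: "'a set set \<Rightarrow> ('a set, 'a set \<times> 'a set) cat" where
  "inclusion_category \<O> =
     \<lparr>Obj = \<O>, Arr = {(U, V). U \<in> \<O> \<and> V \<in> \<O> \<and> U \<subseteq> V}, Dom = fst, Cod = snd,
      Ident = (\<lambda>U. (U, U)), Comp = (\<lambda>(V, W) (U, V'). (U, W))\<rparr>"

definition groupoid_diagram ::
    "('j, 'i) cat \<Rightarrow> ('j \<Rightarrow> ('o, 'm) cat) \<Rightarrow> ('i \<Rightarrow> ('o, 'm, 'o, 'm) functor_maps) \<Rightarrow> bool" where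
  "groupoid_diagram J D T \<longleftrightarrow> category J \<and>
     (\<forall>j\<in>Obj J. groupoid (D j)) \<and>
     (\<forall>u\<in>Arr J. is_functor (D (Dom J u)) (D (Cod J u)) (T u)) \<and>
     (\<forall>j\<in>Obj J. T (Ident J j) = identity_functor (D j)) \<and>
     (\<forall>u\<in>Arr J. \<forall>v\<in>Arr J. Dom J v = Cod J u \<longrightarrow>
        T (Comp J v u) = compose_functors (D (Dom J u)) (T v) (T u))"

definition groupoid_cocone ::
    "('j, 'i) cat \<Rightarrow> ('j \<Rightarrow> ('o, 'm) cat) \<Rightarrow> ('i \<Rightarrow> ('o, 'm, 'o, 'm) functor_maps) \<Rightarrow>
     ('p, 'n) cat \<Rightarrow> ('j \<Rightarrow> ('o, 'm, 'p, 'n) functor_maps) \<Rightarrow> bool" where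
  "groupoid_cocone J D T G \<phi> \<longleftrightarrow> groupoid G \<and>
     (\<forall>j\<in>Obj J. is_functor (D j) G (\<phi> j)) \<and>
     (\<forall>u\<in>Arr J. compose_functors (D (Dom J u)) (\<phi> (Cod J u)) (T u) = \<phi> (Dom J u))"

text \<open>
  The colimit property quantifies over all groupoids. A HOL definition cannot quantify over
  types, so the types of objects and arrows of the test groupoids enter as the parameter
  \<open>TYPE('q \<times> 'r)\<close>; a statement in which \<open>'q\<close> and \<open>'r\<close> are free type variables asserts the universal
  property for groupoids over arbitrary types.
\<close>

definition groupoid_colimit ::
    "('q \<times> 'r) itself \<Rightarrow>
     ('j, 'i) cat \<Rightarrow> ('j \<Rightarrow> ('o, 'm) cat) \<Rightarrow> ('i \<Rightarrow> ('o, 'm, 'o, 'm) functor_maps) \<Rightarrow>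
     ('p, 'n) cat \<Rightarrow> ('j \<Rightarrow> ('o, 'm, 'p, 'n) functor_maps) \<Rightarrow> bool" where
  "groupoid_colimit _ J D T P \<phi> \<longleftrightarrow> groupoid_cocone J D T P \<phi> \<and>
     (\<forall>(G :: ('q, 'r) cat) \<psi>. groupoid_cocone J D T G \<psi> \<longrightarrow>
        (\<exists>!F. is_functor P G F \<and> (\<forall>j\<in>Obj J. compose_functors (D j) F (\<phi> j) = \<psi> j)))"


section \<open>The fundamental groupoid\<close>

definition unit_interval :: "real convergence_space" where
  "unit_interval = topological_space_conv (top_of_set {0..1})"

definition path_between :: "'a convergence_space \<Rightarrow> 'a \<Rightarrow> 'a \<Rightarrow> (real \<Rightarrow> 'a) \<Rightarrow> bool" where
  "path_between X x y \<gamma> \<longleftrightarrow> \<gamma> \<in> continuous_functions unit_interval X \<and> \<gamma> 0 = x \<and> \<gamma> 1 = y"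

definition paths :: "'a convergence_space \<Rightarrow> (real \<Rightarrow> 'a) set" where
  "paths X = {\<gamma>. \<exists>x y. path_between X x y \<gamma>}"

definition rel_homotopic ::
    "'a convergence_space \<Rightarrow> (real \<Rightarrow> 'a) \<Rightarrow> (real \<Rightarrow> 'a) \<Rightarrow> bool" where
  "rel_homotopic X \<gamma> \<gamma>' \<longleftrightarrow>
     (\<exists>x y. path_between X x y \<gamma> \<and> path_between X x y \<gamma>' \<and>
        (\<exists>H. path_between (continuous_convergence unit_interval X) \<gamma> \<gamma>' H \<and>
           (\<forall>t\<in>{0..1}. path_between X x y (H t))))"

definition path_class :: "'a convergence_space \<Rightarrow> (real \<Rightarrow> 'a) \<Rightarrow> (real \<Rightarrow> 'a) set" where
  "path_class X \<gamma> = {\<gamma>'. rel_homotopic X \<gamma> \<gamma>'}"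

definition concat_paths :: "(real \<Rightarrow> 'a) \<Rightarrow> (real \<Rightarrow> 'a) \<Rightarrow> (real \<Rightarrow> 'a)" where
  "concat_paths \<gamma> \<rho> = (\<lambda>t\<in>{0..1}. if t \<le> 1/2 then \<gamma> (2 * t) else \<rho> (2 * t - 1))"

text \<open>
  An arrow is a class of paths. The composite of \<open>[\<gamma>]\<close> followed by \<open>[\<rho>]\<close>, and the image of \<open>[\<gamma>]\<close> under
  a map, are written as unions of \<open>[\<gamma> * \<rho>]\<close> and \<open>[f \<circ> \<gamma>]\<close> over all representatives; all
  members of these unions agree because the operations respect homotopy classes.
\<close>

definition fundamental_groupoid ::
    "'a convergence_space \<Rightarrow> ('a, (real \<Rightarrow> 'a) set) cat" where
  "fundamental_groupoid X =
     \<lparr>Obj = points X,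
      Arr = path_class X ` paths X,
      Dom = (\<lambda>c. THE x. \<forall>\<gamma>\<in>c. \<gamma> 0 = x),
      Cod = (\<lambda>c. THE y. \<forall>\<gamma>\<in>c. \<gamma> 1 = y),
      Ident = (\<lambda>x. path_class X (\<lambda>t\<in>{0..1}. x)),
      Comp = (\<lambda>d c. \<Union>\<gamma>\<in>c. \<Union>\<rho>\<in>d. path_class X (concat_paths \<gamma> \<rho>))\<rparr>"

definition fundamental_groupoid_map ::
    "'a convergence_space \<Rightarrow> 'b convergence_space \<Rightarrow> ('a \<Rightarrow> 'b) \<Rightarrow>
     ('a, (real \<Rightarrow> 'a) set, 'b, (real \<Rightarrow> 'b) set) functor_maps" where
  "fundamental_groupoid_map X Y f =
     \<lparr>on_obj = (\<lambda>x\<in>points X. f x),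
      on_arr = (\<lambda>c\<in>Arr (fundamental_groupoid X). \<Union>\<gamma>\<in>c. path_class Y (compose {0..1} f \<gamma>))\<rparr>"

end

theory Submission
  imports Defs
begin

text \<open>
  A path in the space of paths is the same as a continuous function on the unit square, so
  homotopies can be pasted along closed sets and reparametrized as in topology.

  Let \<open>\<psi>\<close> be a cocone with vertex \<open>G\<close> and \<open>h\<close> a continuous function on a compact convex set \<open>K\<close>.
  By the Lebesgue number lemma \<open>h\<close> maps every short segment of \<open>K\<close> into a member of \<open>\<O>\<close>, and \<open>\<psi>\<close>
  assigns an arrow of \<open>G\<close> to it, independently of the chosen member because \<open>\<O>\<close> is closed under
  intersections. These arrows form a local cocycle on \<open>K\<close>; as \<open>K\<close> is star-shaped, the cocycle has a
  primitive, and on the interval a primitive is determined by its initial value. The value at \<open>1\<close>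
  of the primitive along a path that starts with an identity is the image of the path under the
  mediating functor. A primitive on the square shows that homotopic paths have the
  same image, and every functor extending the cocone yields primitives along paths, hence uniqueness.
\<close>

section \<open>Continuous functions from topological spaces to limit spaces\<close>

text \<open>The obstacle is that a limit space offers no neighbourhoods: a member of
  \<open>\<O>\<close> need not be open in any sense. What a convergence system does give is a member
  inside every convergent filter. Applied to the image of the neighbourhood filter of a point p of K
  under h, this makes the preimage of some member contain a relative neighbourhood of p. All open
  covers and all compactness therefore live in K, a subset of a normed space, and never in X. The
  axioms divide the work as follows. Isotony lets one neighbourhood filter stand for all filters
  converging to p, stability is pasting along two closed sets, and centredness provides constant
  paths and makes \<open>\<O>\<close> cover X. The classical van Kampen argument pushes a path
  across a grid of small squares, one cell at a time. A primitive replaces this bookkeeping: once it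
  exists on the whole square, homotopy invariance amounts to reading its value at one corner along
  two boundary routes. The only geometric input is the triangle identity for straight segments
  inside a single member.\<close>

definition continuous_into ::
    "'b::topological_space set \<Rightarrow> 'a convergence_space \<Rightarrow> ('b \<Rightarrow> 'a) \<Rightarrow> bool" where
  "continuous_into S X h \<longleftrightarrow>
     (\<forall>p\<in>S. h p \<in> points X \<and> h p \<in> limits X (filtermap h (inf (nhds p) (principal S))))"

lemma continuous_into_points: "continuous_into S X h \<Longrightarrow> p \<in> S \<Longrightarrow> h p \<in> points X"
  by (simp add: continuous_into_def)

lemma nhds_within_neq_bot: "p \<in> S \<Longrightarrow> inf (nhds p) (principal S) \<noteq> bot"
  by (auto simp: trivial_limit_def eventually_inf_principal dest: eventually_nhds_x_imp_x)

lemma proper_filter_on_filtermap: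
  assumes "h \<in> S \<rightarrow> T" "F \<noteq> bot" "F \<le> principal S"
  shows "proper_filter_on T (filtermap h F)"
  using assms by (auto simp: proper_filter_on_def filtermap_bot_iff le_principal eventually_filtermap
      elim!: eventually_mono)

lemma limits_antimono:
  assumes "limit_space X" "proper_filter_on (points X) F" "G \<noteq> bot" "G \<le> F" "x \<in> limits X F"
  shows "x \<in> limits X G"
proof -
  have "proper_filter_on (points X) G"
    using assms(2-4) by (auto simp: proper_filter_on_def)
  then show ?thesis
    using assms unfolding limit_space_def isotone_def by blast
qed

text \<open>Isotony at work: the neighbourhood filter of \<open>p\<close> within \<open>S\<close> is
  the coarsest filter on \<open>S\<close> that converges to \<open>p\<close>. This is why
  \<open>continuous_into\<close> tests that filter alone.\<close>

lemma continuous_into_limits: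
  assumes "limit_space X" "continuous_into S X h" "p \<in> S" "F \<noteq> bot"
    and "F \<le> inf (nhds p) (principal S)"
  shows "h p \<in> limits X (filtermap h F)"
proof (rule limits_antimono[OF assms(1)])
  show "proper_filter_on (points X) (filtermap h (inf (nhds p) (principal S)))"
    using assms(2,3) by (intro proper_filter_on_filtermap[of h S])
      (auto simp: nhds_within_neq_bot continuous_into_points)
qed (use assms in \<open>auto simp: filtermap_bot_iff filtermap_mono continuous_into_def\<close>)

lemma continuous_into_compose:
  fixes g :: "'c::topological_space \<Rightarrow> 'b::topological_space"
  assumes "limit_space X" "continuous_into S X h" "continuous_on T g" "g \<in> T \<rightarrow> S"
  shows "continuous_into T X (h \<circ> g)"
  unfolding continuous_into_def
proof (intro ballI conjI)
  fix p assume p: "p \<in> T"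
  then have gp: "g p \<in> S" using assms(4) by auto
  then show "(h \<circ> g) p \<in> points X" using assms(2) by (simp add: continuous_into_def)
  let ?F = "filtermap g (inf (nhds p) (principal T))"
  have "?F \<le> nhds (g p)"
    unfolding le_filter_def
  proof (intro allI impI)
    fix P assume "eventually P (nhds (g p))"
    then obtain B where B: "open B" "g p \<in> B" "\<forall>y\<in>B. P y" by (auto simp: eventually_nhds)
    then obtain A where "open A" "p \<in> A" "\<forall>y\<in>T. y \<in> A \<longrightarrow> g y \<in> B"
      using assms(3) p unfolding continuous_on_topological by meson
    then show "eventually P ?F"
      using B(3) by (auto simp: eventually_filtermap eventually_inf_principal eventually_nhds)
  qed
  moreover have "?F \<le> principal S"
    using assms(4) by (auto simp: le_principal eventually_filtermap eventually_inf_principal Pi_iff)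
  ultimately have "h (g p) \<in> limits X (filtermap h ?F)"
    using p by (intro continuous_into_limits[OF assms(1,2) gp])
      (auto simp: filtermap_bot_iff nhds_within_neq_bot)
  then show "(h \<circ> g) p \<in> limits X (filtermap (h \<circ> g) (inf (nhds p) (principal T)))"
    by (simp add: filtermap_filtermap comp_def)
qed

lemma continuous_into_subset:
  assumes "limit_space X" "continuous_into S X h" "T \<subseteq> S"
  shows "continuous_into T X h"
  using continuous_into_compose[OF assms(1,2), of T "\<lambda>x. x"] assms(3) by (auto simp: comp_def)

lemma continuous_into_cong:
  assumes "continuous_into S X h" "\<And>p. p \<in> S \<Longrightarrow> k p = h p"
  shows "continuous_into S X k"
proof -
  have "filtermap k (inf (nhds p) (principal S)) = filtermap h (inf (nhds p) (principal S))" for p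
    using assms(2) by (auto simp: filter_eq_iff eventually_filtermap eventually_inf_principal
        elim!: eventually_mono)
  then show ?thesis using assms by (simp add: continuous_into_def)
qed

lemma continuous_into_const:
  assumes "limit_space X" "x \<in> points X"
  shows "continuous_into S X (\<lambda>_. x)"
  unfolding continuous_into_def
proof (intro ballI conjI)
  fix p assume p: "p \<in> S"
  have "filtermap (\<lambda>_. x) F = principal {x}" if "F \<noteq> bot" for F :: "'b filter"
    using that by (auto simp: filter_eq_iff eventually_filtermap eventually_principal
        eventually_const_iff)
  then show "x \<in> limits X (filtermap (\<lambda>_. x) (inf (nhds p) (principal S)))"
    using assms nhds_within_neq_bot[OF p] by (simp add: limit_space_def centered_def)
qed (use assms(2) in simp)

text \<open>At a common point of \<open>A\<close> and \<open>B\<close> the neighbourhood filter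
  within the union is the supremum of the two others, so stability applies. At a point outside one
  of the sets, closedness of that set (\<open>away\<close>) leaves only the neighbourhood filter
  within the other.\<close>

lemma continuous_into_Un:
  assumes "limit_space X" "closed A" "closed B" "continuous_into A X h" "continuous_into B X h"
  shows "continuous_into (A \<union> B) X h"
  unfolding continuous_into_def
proof (intro ballI conjI)
  let ?N = "\<lambda>p S. inf (nhds p) (principal S)"
  fix p assume p: "p \<in> A \<union> B"
  then show "h p \<in> points X" using assms(4,5) by (auto simp: continuous_into_def)
  have away: "?N p (C \<union> D) = ?N p C" if "closed D" "p \<notin> D" for C D
  proof -
    have "eventually (\<lambda>x. x \<notin> D) (nhds p)"
      using that by (auto simp: eventually_nhds intro: exI[of _ "- D"])
    then have "eventually (\<lambda>x. (x \<in> C \<union> D \<longrightarrow> P x) = (x \<in> C \<longrightarrow> P x)) (nhds p)" for P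
      by (auto elim: eventually_mono)
    then show ?thesis
      unfolding filter_eq_iff eventually_inf_principal by (intro allI eventually_subst)
  qed
  consider "p \<in> A" "p \<in> B" | "p \<in> A" "p \<notin> B" | "p \<notin> A" "p \<in> B" using p by blast
  then show "h p \<in> limits X (filtermap h (?N p (A \<union> B)))"
  proof cases
    case 1
    have "proper_filter_on (points X) (filtermap h (?N p A))"
      "proper_filter_on (points X) (filtermap h (?N p B))"
      using 1 assms(4,5) proper_filter_on_filtermap[OF _ nhds_within_neq_bot[OF 1(1)], of h A]
        proper_filter_on_filtermap[OF _ nhds_within_neq_bot[OF 1(2)], of h B]
      by (auto simp: continuous_into_def)
    moreover have "h p \<in> limits X (filtermap h (?N p A)) \<inter> limits X (filtermap h (?N p B))"
      using 1 assms(4,5) by (auto simp: continuous_into_def)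
    moreover have "?N p (A \<union> B) = sup (?N p A) (?N p B)"
      by (auto simp: filter_eq_iff eventually_inf_principal eventually_sup
          elim: eventually_mono elim: eventually_elim2)
    ultimately show ?thesis
      using assms(1) unfolding limit_space_def stable_def by (auto simp: filtermap_sup)
  next
    case 2
    then show ?thesis using away[OF assms(3) 2(2), of A] assms(4) by (simp add: continuous_into_def)
  next
    case 3
    then show ?thesis using away[OF assms(2) 3(1), of B] assms(5)
      by (simp add: continuous_into_def Un_commute)
  qed
qed

section \<open>Subspaces\<close>

lemma limit_space_subspace_conv:
  assumes "limit_space X" "U \<subseteq> points X"
  shows "limit_space (subspace_conv X U)"
proof -
  have U: "proper_filter_on (points X) F" if "proper_filter_on U F" for F
    using that assms(2) order_trans[of F "principal U" "principal (points X)"]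
    by (simp add: proper_filter_on_def)
  show ?thesis
    unfolding limit_space_def
  proof (intro conjI)
    show "centered (subspace_conv X U)"
      using assms by (auto simp: centered_def subspace_conv_def limit_space_def)
    show "isotone (subspace_conv X U)"
      using assms(1) U unfolding isotone_def subspace_conv_def limit_space_def by simp blast
    show "stable (subspace_conv X U)"
      using assms(1) U unfolding stable_def subspace_conv_def limit_space_def by simp blast
  qed (simp add: preconvergence_def subspace_conv_def)
qed

lemma points_subspace_conv [simp]: "points (subspace_conv X U) = U"
  by (simp add: subspace_conv_def)

lemma continuous_into_subspace_conv:
  assumes "U \<subseteq> points X"
  shows "continuous_into S (subspace_conv X U) h \<longleftrightarrow> continuous_into S X h \<and> h \<in> S \<rightarrow> U"
  using assms by (auto simp: continuous_into_def subspace_conv_def)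


section \<open>Paths and homotopies in limit spaces\<close>

lemma nhdsin_top_of_set: "x \<in> S \<Longrightarrow> nhdsin (top_of_set S) x = inf (nhds x) (principal S)"
  by (auto simp: filter_eq_iff eventually_nhdsin eventually_inf_principal eventually_nhds
      openin_open)

lemma points_unit_interval [simp]: "points unit_interval = {0..1}"
  by (simp add: unit_interval_def topological_space_conv_def)

lemma limits_unit_interval:
  "t \<in> limits unit_interval F \<longleftrightarrow> t \<in> {0..1} \<and> F \<le> inf (nhds t) (principal {0..1})"
  by (auto simp: unit_interval_def topological_space_conv_def nhdsin_top_of_set)

lemma continuous_functions_unit_interval:
  assumes "limit_space X"
  shows "f \<in> continuous_functions unit_interval X \<longleftrightarrow>
    f \<in> extensional {0..1} \<and> continuous_into {0..1} X f"
proof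
  assume f: "f \<in> continuous_functions unit_interval X"
  have "f t \<in> limits X (filtermap f (inf (nhds t) (principal {0..1})))" if "t \<in> {0..1}" for t
  proof -
    have "proper_filter_on {0..1} (inf (nhds t) (principal {0..1}))"
      using nhds_within_neq_bot[OF that] by (simp add: proper_filter_on_def)
    then show ?thesis
      using f that by (auto simp: continuous_functions_def limits_unit_interval)
  qed
  then show "f \<in> extensional {0..1} \<and> continuous_into {0..1} X f"
    using f by (auto simp: continuous_functions_def continuous_into_def PiE_def)
next
  assume f: "f \<in> extensional {0..1} \<and> continuous_into {0..1} X f"
  then show "f \<in> continuous_functions unit_interval X"
    using assms by (auto simp: continuous_functions_def limits_unit_interval PiE_def Pi_def
        continuous_into_points proper_filter_on_def intro!: continuous_into_limits[of X "{0..1}" f])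
qed

lemma path_between_iff:
  assumes "limit_space X"
  shows "path_between X x y \<gamma> \<longleftrightarrow>
    \<gamma> \<in> extensional {0..1} \<and> continuous_into {0..1} X \<gamma> \<and> \<gamma> 0 = x \<and> \<gamma> 1 = y"
  by (auto simp: path_between_def continuous_functions_unit_interval[OF assms])

section \<open>Paths of paths as functions on the unit square\<close>

lemma nhds_within_Times:
  "inf (nhds (s, t)) (principal (S \<times> T)) =
    inf (nhds s) (principal S) \<times>\<^sub>F inf (nhds t) (principal T)"
  unfolding nhds_prod filter_eq_iff eventually_inf_principal eventually_prod_filter
proof (intro allI iffI)
  fix P
  assume "\<exists>Pf Pg. (\<forall>\<^sub>F x in nhds s. Pf x) \<and> (\<forall>\<^sub>F x in nhds t. Pg x) \<and>
    (\<forall>x y. Pf x \<longrightarrow> Pg y \<longrightarrow> (x, y) \<in> S \<times> T \<longrightarrow> P (x, y))"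
  then obtain Q R where "\<forall>\<^sub>F x in nhds s. Q x" "\<forall>\<^sub>F x in nhds t. R x"
    "\<forall>x y. Q x \<longrightarrow> R y \<longrightarrow> (x, y) \<in> S \<times> T \<longrightarrow> P (x, y)" by blast
  then show "\<exists>Pf Pg. (\<forall>\<^sub>F x in nhds s. x \<in> S \<longrightarrow> Pf x) \<and> (\<forall>\<^sub>F x in nhds t. x \<in> T \<longrightarrow> Pg x) \<and>
    (\<forall>x y. Pf x \<longrightarrow> Pg y \<longrightarrow> P (x, y))"
    by (intro exI[of _ "\<lambda>x. x \<in> S \<and> Q x"] exI[of _ "\<lambda>x. x \<in> T \<and> R x"])
      (auto elim: eventually_mono)
next
  fix P
  assume "\<exists>Pf Pg. (\<forall>\<^sub>F x in nhds s. x \<in> S \<longrightarrow> Pf x) \<and> (\<forall>\<^sub>F x in nhds t. x \<in> T \<longrightarrow> Pg x) \<and>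
    (\<forall>x y. Pf x \<longrightarrow> Pg y \<longrightarrow> P (x, y))"
  then obtain Q R where "\<forall>\<^sub>F x in nhds s. x \<in> S \<longrightarrow> Q x" "\<forall>\<^sub>F x in nhds t. x \<in> T \<longrightarrow> R x"
    "\<forall>x y. Q x \<longrightarrow> R y \<longrightarrow> P (x, y)" by blast
  then show "\<exists>Pf Pg. (\<forall>\<^sub>F x in nhds s. Pf x) \<and> (\<forall>\<^sub>F x in nhds t. Pg x) \<and>
    (\<forall>x y. Pf x \<longrightarrow> Pg y \<longrightarrow> (x, y) \<in> S \<times> T \<longrightarrow> P (x, y))"
    by (intro exI[of _ "\<lambda>x. x \<in> S \<longrightarrow> Q x"] exI[of _ "\<lambda>x. x \<in> T \<longrightarrow> R x"]) auto
qed

text \<open>The left-hand side is the filter that continuous convergence tests along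
  \<open>H\<close>. A predicate on the parameter cannot simply be pushed forward, as
  \<open>H\<close> may fail to be injective; the proof uses the predicate
  \<open>\<lambda>g. \<forall>y. R y \<longrightarrow> P (g y)\<close> on functions instead.\<close>

lemma filtermap_eval_prod:
  "filtermap (\<lambda>(g, a). g a) (filtermap H F \<times>\<^sub>F G) = filtermap (\<lambda>(s, t). H s t) (F \<times>\<^sub>F G)"
proof -
  have "eventually P (filtermap (\<lambda>(g, a). g a) (filtermap H F \<times>\<^sub>F G)) \<longleftrightarrow>
      eventually P (filtermap (\<lambda>(s, t). H s t) (F \<times>\<^sub>F G))" for P
    unfolding eventually_filtermap eventually_prod_filter
  proof
    assume "\<exists>Pf Pg. (\<forall>\<^sub>F x in F. Pf (H x)) \<and> eventually Pg G \<and>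
      (\<forall>x y. Pf x \<longrightarrow> Pg y \<longrightarrow> P (case (x, y) of (g, a) \<Rightarrow> g a))"
    then obtain Q R where "\<forall>\<^sub>F x in F. Q (H x)" "eventually R G" "\<forall>x y. Q x \<longrightarrow> R y \<longrightarrow> P (x y)"
      by auto
    then show "\<exists>Pf Pg. eventually Pf F \<and> eventually Pg G \<and>
        (\<forall>x y. Pf x \<longrightarrow> Pg y \<longrightarrow> P (case (x, y) of (s, t) \<Rightarrow> H s t))"
      by (intro exI[of _ "\<lambda>x. Q (H x)"] exI[of _ R]) auto
  next
    assume "\<exists>Pf Pg. eventually Pf F \<and> eventually Pg G \<and>
        (\<forall>x y. Pf x \<longrightarrow> Pg y \<longrightarrow> P (case (x, y) of (s, t) \<Rightarrow> H s t))"
    then obtain Q R where QR: "eventually Q F" "eventually R G" "\<forall>x y. Q x \<longrightarrow> R y \<longrightarrow> P (H x y)"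
      by auto
    then have "\<forall>\<^sub>F x in F. \<forall>y. R y \<longrightarrow> P (H x y)" by (auto elim: eventually_mono)
    with QR show "\<exists>Pf Pg. (\<forall>\<^sub>F x in F. Pf (H x)) \<and> eventually Pg G \<and>
      (\<forall>x y. Pf x \<longrightarrow> Pg y \<longrightarrow> P (case (x, y) of (g, a) \<Rightarrow> g a))"
      by (intro exI[of _ "\<lambda>g. \<forall>y. R y \<longrightarrow> P (g y)"] exI[of _ R]) auto
  qed
  then show ?thesis by (simp add: filter_eq_iff)
qed

text \<open>The exponential law for the interval. From left to right, continuous convergence is
  tested on neighbourhood filters, whose product is the neighbourhood filter within the square. From
  right to left, the product of any two filters converging in the interval is finer than that
  neighbourhood filter, so isotony applies.\<close>

lemma continuous_functions_curried:
  assumes "limit_space X"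
  shows "H \<in> continuous_functions unit_interval (continuous_convergence unit_interval X) \<longleftrightarrow>
    H \<in> extensional {0..1} \<and> (\<forall>s\<in>{0..1}. H s \<in> extensional {0..1}) \<and>
    continuous_into ({0..1} \<times> {0..1}) X (\<lambda>(s, t). H s t)"
    (is "?L \<longleftrightarrow> ?R")
proof
  assume L: ?L
  let ?I = "{0..1::real}"
  have H: "H s \<in> continuous_functions unit_interval X" if "s \<in> ?I" for s
  proof -
    have "H s \<in> points (continuous_convergence unit_interval X)"
      using L that by (auto simp: continuous_functions_def)
    then show ?thesis by (simp add: continuous_convergence_def)
  qed
  have "continuous_into (?I \<times> ?I) X (\<lambda>(s, t). H s t)"
    unfolding continuous_into_def
  proof (safe)
    fix s t :: real assume s: "s \<in> ?I" and t: "t \<in> ?I"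
    then show "H s t \<in> points X"
      using H[OF s] by (auto simp: continuous_functions_def)
    have "proper_filter_on ?I (inf (nhds s) (principal ?I))"
      "proper_filter_on ?I (inf (nhds t) (principal ?I))"
      using nhds_within_neq_bot[OF s] nhds_within_neq_bot[OF t] by (auto simp: proper_filter_on_def)
    moreover have "s \<in> limits unit_interval (inf (nhds s) (principal ?I))"
      "t \<in> limits unit_interval (inf (nhds t) (principal ?I))"
      using s t by (auto simp: limits_unit_interval)
    ultimately have "H s t \<in> limits X (filtermap (\<lambda>(g, a). g a)
        (filtermap H (inf (nhds s) (principal ?I)) \<times>\<^sub>F inf (nhds t) (principal ?I)))"
      using L unfolding continuous_functions_def[of _ "continuous_convergence _ _"]
      by (simp add: continuous_convergence_def)
    then show "H s t \<in> limits X (filtermap (\<lambda>(s, t). H s t)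
        (inf (nhds (s, t)) (principal (?I \<times> ?I))))"
      by (simp add: filtermap_eval_prod nhds_within_Times)
  qed
  moreover have "H \<in> extensional ?I" using L by (auto simp: continuous_functions_def PiE_def)
  moreover have "\<forall>s\<in>?I. H s \<in> extensional ?I" using H by (auto simp: continuous_functions_def PiE_def)
  ultimately show ?R by blast
next
  assume R: ?R
  let ?I = "{0..1::real}"
  have Hs: "H s \<in> continuous_functions unit_interval X" if "s \<in> ?I" for s
  proof -
    have "continuous_into ?I X ((\<lambda>(s, t). H s t) \<circ> Pair s)"
      using R that by (intro continuous_into_compose[OF assms, of "?I \<times> ?I"] continuous_intros) auto
    then show ?thesis using R that by (simp add: continuous_functions_unit_interval[OF assms] comp_def)
  qed
  moreover have "H s t \<in> limits X (filtermap (\<lambda>(g, a). g a) (filtermap H F \<times>\<^sub>F G))"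
    if FG: "proper_filter_on ?I F" "s \<in> limits unit_interval F"
      "proper_filter_on ?I G" "t \<in> limits unit_interval G" for s t F G
  proof -
    have "F \<times>\<^sub>F G \<le> inf (nhds (s, t)) (principal (?I \<times> ?I))" "F \<times>\<^sub>F G \<noteq> bot" "(s, t) \<in> ?I \<times> ?I"
      using FG by (auto simp: nhds_within_Times limits_unit_interval proper_filter_on_def
          prod_filter_eq_bot intro!: prod_filter_mono)
    then show ?thesis
      using continuous_into_limits[OF assms, of "?I \<times> ?I" "\<lambda>(s, t). H s t" "(s, t)"] R
      by (simp add: filtermap_eval_prod)
  qed
  ultimately have "H s \<in> points (continuous_convergence unit_interval X) \<and>
      (\<forall>F. proper_filter_on {0..1} F \<longrightarrow> s \<in> limits unit_interval F \<longrightarrow>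
        H s \<in> limits (continuous_convergence unit_interval X) (filtermap H F))" if "s \<in> ?I" for s
    using that by (simp add: continuous_convergence_def)
  then show ?L
    using R by (auto simp: continuous_functions_def PiE_def limits_unit_interval)
qed

section \<open>Homotopies of paths\<close>

text \<open>The uncurried form of \<open>rel_homotopic\<close>, with the homotopy parameter as first
  coordinate. Only values on [0,1] enter, so composites such as \<open>f \<circ> a\<close> can be
  used without restricting them. Continuity of both paths and agreement of their end points are
  consequences (\<open>path_homotopicD\<close>).\<close>

definition path_homotopic ::
    "'a convergence_space \<Rightarrow> (real \<Rightarrow> 'a) \<Rightarrow> (real \<Rightarrow> 'a) \<Rightarrow> bool" where
  "path_homotopic X f g \<longleftrightarrow> (\<exists>h :: real \<times> real \<Rightarrow> 'a. continuous_into ({0..1} \<times> {0..1}) X h \<and>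
     (\<forall>t\<in>{0..1}. h (0, t) = f t \<and> h (1, t) = g t) \<and>
     (\<forall>s\<in>{0..1}. h (s, 0) = f 0 \<and> h (s, 1) = f 1))"

lemma path_homotopicI:
  fixes h :: "real \<times> real \<Rightarrow> 'a"
  assumes "continuous_into ({0..1} \<times> {0..1}) X h"
    and "\<And>t. t \<in> {0..1} \<Longrightarrow> h (0, t) = f t" "\<And>t. t \<in> {0..1} \<Longrightarrow> h (1, t) = g t"
    and "\<And>s. s \<in> {0..1} \<Longrightarrow> h (s, 0) = f 0" "\<And>s. s \<in> {0..1} \<Longrightarrow> h (s, 1) = f 1"
  shows "path_homotopic X f g"
  using assms unfolding path_homotopic_def by blast

lemma continuous_into_slice:
  assumes "limit_space X" "continuous_into ({0..1} \<times> {0..1}) X h" "s \<in> {0..1::real}"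
  shows "continuous_into {0..1::real} X (\<lambda>t. h (s, t))"
proof -
  have "continuous_on {0..1::real} (Pair s)" by (intro continuous_intros)
  then show ?thesis
    using continuous_into_compose[OF assms(1,2), of "{0..1}" "Pair s"] assms(3)
    by (auto simp: comp_def)
qed

lemma path_homotopicD:
  assumes "path_homotopic X f g" "limit_space X"
  shows "continuous_into {0..1} X f" "continuous_into {0..1} X g" "g 0 = f 0" "g 1 = f 1"
proof -
  obtain h :: "real \<times> real \<Rightarrow> 'a" where h: "continuous_into ({0..1} \<times> {0..1}) X h"
    "\<And>t. t \<in> {0..1} \<Longrightarrow> h (0, t) = f t" "\<And>t. t \<in> {0..1} \<Longrightarrow> h (1, t) = g t"
    "\<And>s. s \<in> {0..1} \<Longrightarrow> h (s, 0) = f 0" "\<And>s. s \<in> {0..1} \<Longrightarrow> h (s, 1) = f 1"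
    using assms(1) unfolding path_homotopic_def by blast
  show "continuous_into {0..1} X f" "continuous_into {0..1} X g"
    using continuous_into_slice[OF assms(2) h(1), of 0] continuous_into_slice[OF assms(2) h(1), of 1]
      h(2,3) by (auto intro: continuous_into_cong)
  show "g 0 = f 0" "g 1 = f 1" using h(3)[of 0] h(4)[of 1] h(3)[of 1] h(5)[of 1] by auto
qed

lemma rel_homotopic_iff:
  assumes "limit_space X"
  shows "rel_homotopic X f g \<longleftrightarrow>
    f \<in> extensional {0..1} \<and> g \<in> extensional {0..1} \<and> path_homotopic X f g"
proof
  assume "rel_homotopic X f g"
  then obtain x y H where fg: "path_between X x y f" "path_between X x y g"
    and H: "path_between (continuous_convergence unit_interval X) f g H"
      "\<forall>t\<in>{0..1}. path_between X x y (H t)"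
    unfolding rel_homotopic_def by blast
  have "continuous_into ({0..1} \<times> {0..1}) X (\<lambda>(s, t). H s t)"
    using H(1) by (simp add: path_between_def continuous_functions_curried[OF assms])
  moreover have "H 0 = f" "H 1 = g" using H(1) by (auto simp: path_between_def)
  ultimately have "path_homotopic X f g"
    using H(2) fg by (intro path_homotopicI[of X "\<lambda>(s, t). H s t"]) (auto simp: path_between_def)
  then show "f \<in> extensional {0..1} \<and> g \<in> extensional {0..1} \<and> path_homotopic X f g"
    using fg by (auto simp: path_between_iff[OF assms])
next
  assume fg: "f \<in> extensional {0..1} \<and> g \<in> extensional {0..1} \<and> path_homotopic X f g"
  then obtain h :: "real \<times> real \<Rightarrow> 'a" where h: "continuous_into ({0..1} \<times> {0..1}) X h"
    "\<And>t. t \<in> {0..1} \<Longrightarrow> h (0, t) = f t" "\<And>t. t \<in> {0..1} \<Longrightarrow> h (1, t) = g t"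
    "\<And>s. s \<in> {0..1} \<Longrightarrow> h (s, 0) = f 0" "\<And>s. s \<in> {0..1} \<Longrightarrow> h (s, 1) = f 1"
    unfolding path_homotopic_def by blast
  define H where "H = (\<lambda>s\<in>{0..1::real}. \<lambda>t\<in>{0..1::real}. h (s, t))"
  have "H 0 = f" "H 1 = g"
    using fg h(2,3) by (auto simp: H_def intro!: extensionalityI[of _ "{0..1}"])
  moreover have "continuous_into ({0..1} \<times> {0..1}) X (\<lambda>(s, t). H s t)"
    by (rule continuous_into_cong[OF h(1)]) (auto simp: H_def)
  moreover have "H \<in> extensional {0..1}" "\<forall>s\<in>{0..1}. H s \<in> extensional {0..1}"
    by (simp_all add: H_def)
  ultimately have "path_between (continuous_convergence unit_interval X) f g H"
    by (simp add: path_between_def continuous_functions_curried[OF assms])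
  moreover have "path_between X (f 0) (f 1) (H s)" if "s \<in> {0..1}" for s
    using continuous_into_cong[OF continuous_into_slice[OF assms h(1) that], of "H s"] h(4,5) that
    by (simp add: path_between_iff[OF assms] H_def)
  moreover have "path_between X (f 0) (f 1) f" "path_between X (f 0) (f 1) g"
    using fg path_homotopicD[OF _ assms, of f g] by (simp_all add: path_between_iff[OF assms])
  ultimately show "rel_homotopic X f g"
    unfolding rel_homotopic_def by blast
qed


lemma path_homotopic_cong:
  assumes "path_homotopic X f g" "\<And>t. t \<in> {0..1} \<Longrightarrow> f' t = f t" "\<And>t. t \<in> {0..1} \<Longrightarrow> g' t = g t"
  shows "path_homotopic X f' g'"
  using assms by (auto simp: path_homotopic_def)

text \<open>The straight-line homotopy from \<open>a\<close> to \<open>b\<close> stays in the convex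
  set \<open>K\<close> and is then mapped by \<open>h\<close>. The unit, associativity and inverse
  laws of the groupoid and the triangle identity for segments all come from this homotopy.\<close>

lemma path_homotopic_reparametrize:
  fixes K :: "'b::real_normed_vector set"
  assumes "limit_space X" "convex K" "continuous_into K X h"
    and "continuous_on {0..1} a" "continuous_on {0..1} b" "a \<in> {0..1} \<rightarrow> K" "b \<in> {0..1} \<rightarrow> K"
    and "a 0 = b 0" "a 1 = b 1"
  shows "path_homotopic X (h \<circ> a) (h \<circ> b)"
proof (rule path_homotopicI)
  let ?g = "\<lambda>z. (1 - fst z) *\<^sub>R a (snd z) + fst z *\<^sub>R b (snd z)"
  have "continuous_on ({0..1} \<times> {0..1}) ?g"
    by (intro continuous_intros continuous_on_compose2[OF assms(4)] continuous_on_compose2[OF assms(5)])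
      auto
  moreover have "?g \<in> {0..1} \<times> {0..1} \<rightarrow> K"
    using assms(2,6,7) by (auto intro!: convexD)
  ultimately show "continuous_into ({0..1} \<times> {0..1}) X (h \<circ> ?g)"
    by (rule continuous_into_compose[OF assms(1,3)])
  fix s :: real
  show "(h \<circ> ?g) (s, 0) = (h \<circ> a) 0" "(h \<circ> ?g) (s, 1) = (h \<circ> a) 1"
    by (simp_all add: assms(8,9) flip: scaleR_left_distrib)
qed auto

lemma path_homotopic_reparametrize_interval:
  assumes "limit_space X" "continuous_into {0..1} X f"
    and "continuous_on {0..1} a" "a \<in> {0..1} \<rightarrow> {0..1}" "a 0 = 0" "a 1 = 1"
  shows "path_homotopic X f (f \<circ> a)"
  using path_homotopic_reparametrize[OF assms(1) _ assms(2), of "\<lambda>x. x" a] assms(3-)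
  by (simp add: comp_def)

lemma path_homotopic_refl:
  assumes "limit_space X" "continuous_into {0..1} X f"
  shows "path_homotopic X f f"
  using path_homotopic_reparametrize_interval[OF assms, of "\<lambda>x. x"] by (simp add: comp_def)

lemma path_homotopic_sym:
  assumes "limit_space X" "path_homotopic X f g"
  shows "path_homotopic X g f"
proof -
  note D = path_homotopicD[OF assms(2,1)]
  obtain h :: "real \<times> real \<Rightarrow> 'a" where h: "continuous_into ({0..1} \<times> {0..1}) X h"
    "\<And>t. t \<in> {0..1} \<Longrightarrow> h (0, t) = f t" "\<And>t. t \<in> {0..1} \<Longrightarrow> h (1, t) = g t"
    "\<And>s. s \<in> {0..1} \<Longrightarrow> h (s, 0) = f 0" "\<And>s. s \<in> {0..1} \<Longrightarrow> h (s, 1) = f 1"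
    using assms(2) unfolding path_homotopic_def by blast
  have "continuous_into ({0..1} \<times> {0..1}) X (h \<circ> (\<lambda>z. (1 - fst z, snd z)))"
    by (rule continuous_into_compose[OF assms(1) h(1)]) (auto intro!: continuous_intros)
  then show ?thesis
    by (rule path_homotopicI) (use h(2-) D in auto)
qed

lemma path_homotopic_trans:
  assumes "limit_space X" "path_homotopic X f g" "path_homotopic X g k"
  shows "path_homotopic X f k"
proof -
  note D = path_homotopicD[OF assms(2,1)]
  obtain h :: "real \<times> real \<Rightarrow> 'a" where h: "continuous_into ({0..1} \<times> {0..1}) X h"
    "\<And>t. t \<in> {0..1} \<Longrightarrow> h (0, t) = f t" "\<And>t. t \<in> {0..1} \<Longrightarrow> h (1, t) = g t"
    "\<And>s. s \<in> {0..1} \<Longrightarrow> h (s, 0) = f 0" "\<And>s. s \<in> {0..1} \<Longrightarrow> h (s, 1) = f 1"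
    using assms(2) unfolding path_homotopic_def by blast
  obtain h' :: "real \<times> real \<Rightarrow> 'a" where h': "continuous_into ({0..1} \<times> {0..1}) X h'"
    "\<And>t. t \<in> {0..1} \<Longrightarrow> h' (0, t) = g t" "\<And>t. t \<in> {0..1} \<Longrightarrow> h' (1, t) = k t"
    "\<And>s. s \<in> {0..1} \<Longrightarrow> h' (s, 0) = g 0" "\<And>s. s \<in> {0..1} \<Longrightarrow> h' (s, 1) = g 1"
    using assms(3) unfolding path_homotopic_def by blast
  define H where "H = (\<lambda>z. if fst z \<le> 1/2 then h (2 * fst z, snd z) else h' (2 * fst z - 1, snd z))"
  have "continuous_into ({0..1/2} \<times> {0..1}) X (h \<circ> (\<lambda>z. (2 * fst z, snd z)))"
    by (rule continuous_into_compose[OF assms(1) h(1)]) (auto intro!: continuous_intros)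
  then have 1: "continuous_into ({0..1/2} \<times> {0..1}) X H"
    by (rule continuous_into_cong) (auto simp: H_def)
  have "continuous_into ({1/2..1} \<times> {0..1}) X (h' \<circ> (\<lambda>z. (2 * fst z - 1, snd z)))"
    by (rule continuous_into_compose[OF assms(1) h'(1)]) (auto intro!: continuous_intros)
  \<comment> \<open>On the seam \<open>fst z = 1/2\<close> the definition of \<open>H\<close> takes
    the first branch; both branches give \<open>g\<close> there.\<close>
  moreover have "H z = (h' \<circ> (\<lambda>z. (2 * fst z - 1, snd z))) z" if z: "z \<in> {1/2..1} \<times> {0..1}" for z
  proof (cases "fst z = 1/2")
    case True
    then have [simp]: "2 * fst z = 1" by simp
    show ?thesis
      using True z h(3)[of "snd z"] h'(2)[of "snd z"] by (simp add: H_def mem_Times_iff)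
  qed (use z in \<open>auto simp: H_def\<close>)
  ultimately have 2: "continuous_into ({1/2..1} \<times> {0..1}) X H"
    by (rule continuous_into_cong)
  have "({0..1} \<times> {0..1} :: (real \<times> real) set) = {0..1/2} \<times> {0..1} \<union> {1/2..1} \<times> {0..1}" by auto
  then have "continuous_into ({0..1} \<times> {0..1}) X H"
    using continuous_into_Un[OF assms(1) _ _ 1 2] by (auto intro: closed_Times)
  then show ?thesis
    by (rule path_homotopicI) (use h(2-) h'(2-) D in \<open>auto simp: H_def\<close>)
qed

section \<open>Concatenation of paths\<close>

text \<open>The formula of \<open>concat_paths\<close> without the restriction to [0,1], so that
  composing with a map distributes over it as an equality of HOL functions
  (\<open>compose_join_paths\<close>).\<close>

definition join_paths :: "(real \<Rightarrow> 'a) \<Rightarrow> (real \<Rightarrow> 'a) \<Rightarrow> real \<Rightarrow> 'a" where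
  "join_paths f g = (\<lambda>t. if t \<le> 1/2 then f (2 * t) else g (2 * t - 1))"

lemma join_paths_ends [simp]: "join_paths f g 0 = f 0" "join_paths f g 1 = g 1"
  by (simp_all add: join_paths_def)

lemma compose_join_paths: "h \<circ> join_paths f g = join_paths (h \<circ> f) (h \<circ> g)"
  by (auto simp: join_paths_def)

lemma path_homotopic_join:
  assumes "limit_space X" "path_homotopic X f f'" "path_homotopic X g g'" "f 1 = g 0"
  shows "path_homotopic X (join_paths f g) (join_paths f' g')"
proof -
  obtain h :: "real \<times> real \<Rightarrow> 'a" where h: "continuous_into ({0..1} \<times> {0..1}) X h"
    "\<And>t. t \<in> {0..1} \<Longrightarrow> h (0, t) = f t" "\<And>t. t \<in> {0..1} \<Longrightarrow> h (1, t) = f' t"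
    "\<And>s. s \<in> {0..1} \<Longrightarrow> h (s, 0) = f 0" "\<And>s. s \<in> {0..1} \<Longrightarrow> h (s, 1) = f 1"
    using assms(2) unfolding path_homotopic_def by blast
  obtain h' :: "real \<times> real \<Rightarrow> 'a" where h': "continuous_into ({0..1} \<times> {0..1}) X h'"
    "\<And>t. t \<in> {0..1} \<Longrightarrow> h' (0, t) = g t" "\<And>t. t \<in> {0..1} \<Longrightarrow> h' (1, t) = g' t"
    "\<And>s. s \<in> {0..1} \<Longrightarrow> h' (s, 0) = g 0" "\<And>s. s \<in> {0..1} \<Longrightarrow> h' (s, 1) = g 1"
    using assms(3) unfolding path_homotopic_def by blast
  define H where "H = (\<lambda>z. if snd z \<le> 1/2 then h (fst z, 2 * snd z) else h' (fst z, 2 * snd z - 1))"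
  have "continuous_into ({0..1} \<times> {0..1/2}) X (h \<circ> (\<lambda>z. (fst z, 2 * snd z)))"
    by (rule continuous_into_compose[OF assms(1) h(1)]) (auto intro!: continuous_intros)
  then have 1: "continuous_into ({0..1} \<times> {0..1/2}) X H"
    by (rule continuous_into_cong) (auto simp: H_def)
  have "continuous_into ({0..1} \<times> {1/2..1}) X (h' \<circ> (\<lambda>z. (fst z, 2 * snd z - 1)))"
    by (rule continuous_into_compose[OF assms(1) h'(1)]) (auto intro!: continuous_intros)
  \<comment> \<open>On the seam \<open>snd z = 1/2\<close> the two branches give \<open>f 1\<close>
    and \<open>g 0\<close>, which agree by assumption.\<close>
  moreover have "H z = (h' \<circ> (\<lambda>z. (fst z, 2 * snd z - 1))) z" if z: "z \<in> {0..1} \<times> {1/2..1}" for z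
  proof (cases "snd z = 1/2")
    case True
    then have [simp]: "2 * snd z = 1" by simp
    show ?thesis
      using True z h(5)[of "fst z"] h'(4)[of "fst z"] assms(4) by (simp add: H_def mem_Times_iff)
  qed (use z in \<open>auto simp: H_def\<close>)
  ultimately have 2: "continuous_into ({0..1} \<times> {1/2..1}) X H"
    by (rule continuous_into_cong)
  have "({0..1} \<times> {0..1} :: (real \<times> real) set) = {0..1} \<times> {0..1/2} \<union> {0..1} \<times> {1/2..1}" by auto
  then have "continuous_into ({0..1} \<times> {0..1}) X H"
    using continuous_into_Un[OF assms(1) _ _ 1 2] by (auto intro: closed_Times)
  then show ?thesis
    by (rule path_homotopicI) (use h(2-) h'(2-) in \<open>auto simp: H_def join_paths_def\<close>)
qed

text \<open>No second pasting argument: the joined path is an edge of the square obtained by joining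
  two constant homotopies.\<close>

lemma continuous_into_join:
  assumes "limit_space X" "continuous_into {0..1} X f" "continuous_into {0..1} X g" "f 1 = g 0"
  shows "continuous_into {0..1} X (join_paths f g)"
  using path_homotopicD(1)[OF path_homotopic_join[OF assms(1)
      path_homotopic_refl[OF assms(1,2)] path_homotopic_refl[OF assms(1,3)] assms(4)] assms(1)] .


section \<open>The fundamental groupoid\<close>

text \<open>Arrows are handled through arbitrary functions continuous on [0,1] as representatives;
  the restriction needed for membership in \<open>paths\<close> is hidden here.\<close>

definition homotopy_class :: "'a convergence_space \<Rightarrow> (real \<Rightarrow> 'a) \<Rightarrow> (real \<Rightarrow> 'a) set" where
  "homotopy_class X f = path_class X (restrict f {0..1})"

lemma mem_homotopy_class:
  assumes "limit_space X"
  shows "\<gamma> \<in> homotopy_class X f \<longleftrightarrow> \<gamma> \<in> extensional {0..1} \<and> path_homotopic X f \<gamma>"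
  by (auto simp: homotopy_class_def path_class_def rel_homotopic_iff[OF assms] path_homotopic_def)

lemma homotopy_class_eq_iff:
  assumes "limit_space X" "continuous_into {0..1} X f"
  shows "homotopy_class X f = homotopy_class X g \<longleftrightarrow> path_homotopic X f g"
proof
  assume eq: "homotopy_class X f = homotopy_class X g"
  have "path_homotopic X f (restrict f {0..1})"
    by (rule path_homotopic_cong[OF path_homotopic_refl[OF assms]]) auto
  then have "restrict f {0..1} \<in> homotopy_class X g"
    by (simp add: eq[symmetric] mem_homotopy_class[OF assms(1)])
  then have "path_homotopic X g f"
    by (auto simp: mem_homotopy_class[OF assms(1)] path_homotopic_def)
  then show "path_homotopic X f g" by (rule path_homotopic_sym[OF assms(1)])
next
  assume "path_homotopic X f g"
  then show "homotopy_class X f = homotopy_class X g"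
    unfolding set_eq_iff mem_homotopy_class[OF assms(1)]
    by (meson path_homotopic_trans[OF assms(1)] path_homotopic_sym[OF assms(1)])
qed

lemma homotopy_class_cong:
  "(\<And>t. t \<in> {0..1} \<Longrightarrow> f t = g t) \<Longrightarrow> homotopy_class X f = homotopy_class X g"
  unfolding homotopy_class_def by (rule arg_cong[OF restrict_ext]) auto

lemma restrict_mem_homotopy_class:
  assumes "limit_space X" "continuous_into {0..1} X f"
  shows "restrict f {0..1} \<in> homotopy_class X f"
  using path_homotopic_cong[OF path_homotopic_refl[OF assms], of f "restrict f {0..1}"]
  by (simp add: mem_homotopy_class[OF assms(1)])

lemma Obj_fundamental_groupoid [simp]: "Obj (fundamental_groupoid X) = points X"
  by (simp add: fundamental_groupoid_def)

lemma Arr_fundamental_groupoid: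
  assumes "limit_space X"
  shows "Arr (fundamental_groupoid X) = homotopy_class X ` {f. continuous_into {0..1} X f}"
proof -
  have "paths X = (\<lambda>f. restrict f {0..1}) ` {f. continuous_into {0..1} X f}"
  proof (intro equalityI subsetI)
    fix f assume "f \<in> paths X"
    then show "f \<in> (\<lambda>f. restrict f {0..1}) ` {f. continuous_into {0..1} X f}"
      by (intro image_eqI[of _ _ f]) (auto simp: paths_def path_between_iff[OF assms]
          extensional_restrict)
  qed (auto simp: paths_def path_between_iff[OF assms] elim: continuous_into_cong)
  then show ?thesis
    by (auto simp: fundamental_groupoid_def homotopy_class_def)
qed

lemma
  assumes "limit_space X" "continuous_into {0..1} X f"
  shows homotopy_class_in_Arr: "homotopy_class X f \<in> Arr (fundamental_groupoid X)"
    and Dom_homotopy_class: "Dom (fundamental_groupoid X) (homotopy_class X f) = f 0"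
    and Cod_homotopy_class: "Cod (fundamental_groupoid X) (homotopy_class X f) = f 1"
proof -
  show "homotopy_class X f \<in> Arr (fundamental_groupoid X)"
    using assms by (simp add: Arr_fundamental_groupoid)
  have "\<gamma> 0 = f 0" "\<gamma> 1 = f 1" if "\<gamma> \<in> homotopy_class X f" for \<gamma>
    using path_homotopicD[OF _ assms(1)] that by (auto simp: mem_homotopy_class[OF assms(1)])
  then have ends: "\<forall>\<gamma>\<in>homotopy_class X f. \<gamma> 0 = f 0" "\<forall>\<gamma>\<in>homotopy_class X f. \<gamma> 1 = f 1"
    by blast+
  \<comment> \<open>The class is nonempty, which makes the definite descriptions of its end points
    unique.\<close>
  note mem = restrict_mem_homotopy_class[OF assms]
  have "(THE x. \<forall>\<gamma>\<in>homotopy_class X f. \<gamma> 0 = x) = f 0"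
  proof (rule the_equality)
    show "x = f 0" if "\<forall>\<gamma>\<in>homotopy_class X f. \<gamma> 0 = x" for x
      using bspec[OF that mem] by simp
  qed (fact ends)
  moreover have "(THE y. \<forall>\<gamma>\<in>homotopy_class X f. \<gamma> 1 = y) = f 1"
  proof (rule the_equality)
    show "x = f 1" if "\<forall>\<gamma>\<in>homotopy_class X f. \<gamma> 1 = x" for x
      using bspec[OF that mem] by simp
  qed (fact ends)
  ultimately show "Dom (fundamental_groupoid X) (homotopy_class X f) = f 0"
    "Cod (fundamental_groupoid X) (homotopy_class X f) = f 1"
    by (simp_all add: fundamental_groupoid_def)
qed

lemma Ident_fundamental_groupoid:
  "Ident (fundamental_groupoid X) x = homotopy_class X (\<lambda>_. x)"
  by (simp add: fundamental_groupoid_def homotopy_class_def)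

lemma Comp_homotopy_class:
  assumes "limit_space X" "continuous_into {0..1} X f" "continuous_into {0..1} X g" "f 1 = g 0"
  shows "Comp (fundamental_groupoid X) (homotopy_class X g) (homotopy_class X f) =
    homotopy_class X (join_paths f g)"
proof -
  have "path_class X (concat_paths \<gamma> \<rho>) = homotopy_class X (join_paths f g)"
    if "\<gamma> \<in> homotopy_class X f" "\<rho> \<in> homotopy_class X g" for \<gamma> \<rho>
  proof -
    have "path_homotopic X (join_paths f g) (join_paths \<gamma> \<rho>)"
      using that assms(4) by (intro path_homotopic_join[OF assms(1)])
        (auto simp: mem_homotopy_class[OF assms(1)])
    then have "homotopy_class X (join_paths f g) = homotopy_class X (join_paths \<gamma> \<rho>)"
      by (simp add: homotopy_class_eq_iff[OF assms(1) continuous_into_join[OF assms]])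
    then show ?thesis
      by (simp add: homotopy_class_def concat_paths_def join_paths_def)
  qed
  then show ?thesis
    using restrict_mem_homotopy_class[OF assms(1,2)] restrict_mem_homotopy_class[OF assms(1,3)]
    by (auto simp: fundamental_groupoid_def)
qed

lemma Arr_fundamental_groupoidE:
  assumes "limit_space X" "c \<in> Arr (fundamental_groupoid X)"
  obtains f where "continuous_into {0..1} X f" "c = homotopy_class X f"
  using assms by (auto simp: Arr_fundamental_groupoid)

text \<open>Waiting at an end point is a reparametrization of \<open>f\<close>: by
  \<open>min (2 * t) 1\<close> for waiting at the end and by \<open>max 0 (2 * t - 1)\<close> for
  waiting at the start.\<close>

lemma path_homotopic_join_const:
  assumes "limit_space X" "continuous_into {0..1} X f"
  shows "path_homotopic X f (join_paths f (\<lambda>_. f 1))" "path_homotopic X f (join_paths (\<lambda>_. f 0) f)"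
proof -
  have "path_homotopic X f (f \<circ> (\<lambda>t. min (2 * t) 1))"
    by (rule path_homotopic_reparametrize_interval[OF assms]) (auto intro!: continuous_intros)
  then show "path_homotopic X f (join_paths f (\<lambda>_. f 1))"
    by (rule path_homotopic_cong) (auto simp: join_paths_def min_def)
  have "path_homotopic X f (f \<circ> (\<lambda>t. max 0 (2 * t - 1)))"
    by (rule path_homotopic_reparametrize_interval[OF assms]) (auto intro!: continuous_intros)
  moreover have "max 0 (2 * t - 1) = (if t \<le> 1/2 then 0 else 2 * t - 1)" for t :: real
    by auto
  ultimately show "path_homotopic X f (join_paths (\<lambda>_. f 0) f)"
    by (simp add: join_paths_def comp_def if_distrib)
qed

lemma path_homotopic_join_assoc:
  assumes "limit_space X" "continuous_into {0..1} X f" "continuous_into {0..1} X g"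
    "continuous_into {0..1} X k" "f 1 = g 0" "g 1 = k 0"
  shows "path_homotopic X (join_paths f (join_paths g k)) (join_paths (join_paths f g) k)"
proof -
  have "continuous_into {0..1} X (join_paths f (join_paths g k))"
    using assms by (intro continuous_into_join) simp_all
  \<comment> \<open>The piecewise linear map that sends the break points 1/4 and 1/2 of the
    right-hand path to the break points 1/2 and 3/4 of the left-hand one. Its slopes 2, 1, 1/2
    decrease, so it is the minimum of its three linear pieces.\<close>
  moreover have "continuous_on {0..1} (\<lambda>t::real. min (2 * t) (min (t + 1/4) ((t + 1) / 2)))"
    by (intro continuous_intros) auto
  ultimately have "path_homotopic X (join_paths f (join_paths g k))
      ((join_paths f (join_paths g k)) \<circ> (\<lambda>t. min (2 * t) (min (t + 1/4) ((t + 1) / 2))))"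
    by (rule path_homotopic_reparametrize_interval[OF assms(1)]) (auto simp: min_def)
  then show ?thesis
  proof (rule path_homotopic_cong)
    fix t :: real assume "t \<in> {0..1}"
    consider "t \<le> 1/4" | "1/4 < t" "t \<le> 1/2" | "1/2 < t" by linarith
    then show "(join_paths (join_paths f g) k) t =
        ((join_paths f (join_paths g k)) \<circ> (\<lambda>t. min (2 * t) (min (t + 1/4) ((t + 1) / 2)))) t"
      by cases (auto simp: join_paths_def min_def diff_divide_distrib add_divide_distrib algebra_simps)
  qed simp
qed

text \<open>Going along \<open>f\<close> and back is \<open>f\<close> after the tent map
  \<open>1 - \<bar>2 * t - 1\<bar>\<close>, which vanishes at both ends and so can be deformed
  within the interval to the constant 0.\<close>

lemma path_homotopic_join_reverse:
  assumes "limit_space X" "continuous_into {0..1} X f"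
  shows "path_homotopic X (\<lambda>_. f 0) (join_paths f (\<lambda>t. f (1 - t)))"
proof -
  have "path_homotopic X (f \<circ> (\<lambda>_. 0)) (f \<circ> (\<lambda>t. 1 - \<bar>2 * t - 1\<bar>))"
    by (rule path_homotopic_reparametrize[OF assms(1) _ assms(2)]) (auto intro!: continuous_intros)
  then show ?thesis
  proof (rule path_homotopic_cong)
    fix t :: real
    show "(join_paths f (\<lambda>t. f (1 - t))) t = (f \<circ> (\<lambda>t. 1 - \<bar>2 * t - 1\<bar>)) t"
      by (auto simp: join_paths_def abs_if field_simps)
  qed simp
qed

lemma continuous_into_reverse:
  assumes "limit_space X" "continuous_into {0..1::real} X f"
  shows "continuous_into {0..1::real} X (\<lambda>t. f (1 - t))"
proof -
  have "continuous_into {0..1} X (f \<circ> (\<lambda>t::real. 1 - t))"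
    by (rule continuous_into_compose[OF assms]) (auto intro!: continuous_intros)
  then show ?thesis by (simp add: comp_def)
qed

lemma groupoid_fundamental_groupoid:
  assumes X: "limit_space X"
  shows "groupoid (fundamental_groupoid X)"
proof -
  note [simp] = homotopy_class_in_Arr[OF X] Dom_homotopy_class[OF X] Cod_homotopy_class[OF X]
    Comp_homotopy_class[OF X] Ident_fundamental_groupoid continuous_into_join[OF X]
    continuous_into_const[OF X] continuous_into_points continuous_into_reverse[OF X]
  have "category (fundamental_groupoid X)"
    unfolding category_def
  proof (intro conjI ballI impI)
    fix c assume "c \<in> Arr (fundamental_groupoid X)"
    then obtain f where f: "continuous_into {0..1} X f" "c = homotopy_class X f"
      by (rule Arr_fundamental_groupoidE[OF X])
    show "Dom (fundamental_groupoid X) c \<in> Obj (fundamental_groupoid X)"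
      "Cod (fundamental_groupoid X) c \<in> Obj (fundamental_groupoid X)" using f by auto
    show "Comp (fundamental_groupoid X) c
        (Ident (fundamental_groupoid X) (Dom (fundamental_groupoid X) c)) = c"
      "Comp (fundamental_groupoid X)
        (Ident (fundamental_groupoid X) (Cod (fundamental_groupoid X) c)) c = c"
      using f path_homotopic_join_const[OF X f(1)] homotopy_class_eq_iff[OF X f(1)] by auto
    fix d assume "d \<in> Arr (fundamental_groupoid X)"
    then obtain g where g: "continuous_into {0..1} X g" "d = homotopy_class X g"
      by (rule Arr_fundamental_groupoidE[OF X])
    assume d: "Dom (fundamental_groupoid X) d = Cod (fundamental_groupoid X) c"
    then show "Comp (fundamental_groupoid X) d c \<in> Arr (fundamental_groupoid X)"
      "Dom (fundamental_groupoid X) (Comp (fundamental_groupoid X) d c) =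
        Dom (fundamental_groupoid X) c"
      "Cod (fundamental_groupoid X) (Comp (fundamental_groupoid X) d c) =
        Cod (fundamental_groupoid X) d"
      using f g by auto
    fix e assume "e \<in> Arr (fundamental_groupoid X)"
    then obtain k where k: "continuous_into {0..1} X k" "e = homotopy_class X k"
      by (rule Arr_fundamental_groupoidE[OF X])
    assume "Dom (fundamental_groupoid X) e = Cod (fundamental_groupoid X) d"
    then show "Comp (fundamental_groupoid X) e (Comp (fundamental_groupoid X) d c) =
        Comp (fundamental_groupoid X) (Comp (fundamental_groupoid X) e d) c"
      using d f g k path_homotopic_join_assoc[OF X f(1) g(1) k(1)]
        homotopy_class_eq_iff[OF X, of "join_paths f (join_paths g k)" "join_paths (join_paths f g) k"] by auto
  qed auto
  moreover have "\<exists>d\<in>Arr (fundamental_groupoid X).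
      Dom (fundamental_groupoid X) d = Cod (fundamental_groupoid X) c \<and>
      Cod (fundamental_groupoid X) d = Dom (fundamental_groupoid X) c \<and>
      Comp (fundamental_groupoid X) d c =
        Ident (fundamental_groupoid X) (Dom (fundamental_groupoid X) c) \<and>
      Comp (fundamental_groupoid X) c d =
        Ident (fundamental_groupoid X) (Cod (fundamental_groupoid X) c)"
    if c: "c \<in> Arr (fundamental_groupoid X)" for c
  proof -
    obtain f where f: "continuous_into {0..1} X f" "c = homotopy_class X f"
      using c by (rule Arr_fundamental_groupoidE[OF X])
    have "homotopy_class X (join_paths f (\<lambda>t. f (1 - t))) = homotopy_class X (\<lambda>_. f 0)"
      using path_homotopic_join_reverse[OF X f(1)] f(1)
        homotopy_class_eq_iff[OF X, of "\<lambda>_. f 0" "join_paths f (\<lambda>t. f (1 - t))"] by simp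
    \<comment> \<open>The other inverse law is the same lemma applied to the reversed path, whose
      reverse is \<open>f\<close>.\<close>
    moreover have "homotopy_class X (join_paths (\<lambda>t. f (1 - t)) f) = homotopy_class X (\<lambda>_. f 1)"
      using path_homotopic_join_reverse[OF X continuous_into_reverse[OF X f(1)]] f(1)
        homotopy_class_eq_iff[OF X, of "\<lambda>_. f 1" "join_paths (\<lambda>t. f (1 - t)) f"] by simp
    ultimately show ?thesis
      using f by (intro bexI[of _ "homotopy_class X (\<lambda>t. f (1 - t))"]) auto
  qed
  ultimately show ?thesis unfolding groupoid_def by blast
qed

section \<open>Functoriality of the fundamental groupoid\<close>

text \<open>Continuity without the extensionality built into \<open>continuous_functions\<close>, so
  that every inclusion is simply \<open>\<lambda>x. x\<close>.\<close>

definition preserves_convergence ::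
    "'a convergence_space \<Rightarrow> 'b convergence_space \<Rightarrow> ('a \<Rightarrow> 'b) \<Rightarrow> bool" where
  "preserves_convergence Y Z f \<longleftrightarrow> f \<in> points Y \<rightarrow> points Z \<and>
     (\<forall>F x. proper_filter_on (points Y) F \<longrightarrow> x \<in> limits Y F \<longrightarrow> f x \<in> limits Z (filtermap f F))"

lemma preserves_convergence_compose:
  assumes "preserves_convergence Y Z f" "continuous_into S Y h"
  shows "continuous_into S Z (f \<circ> h)"
  unfolding continuous_into_def
proof (intro ballI conjI)
  fix p assume p: "p \<in> S"
  show "(f \<circ> h) p \<in> points Z"
    using assms p by (auto simp: preserves_convergence_def continuous_into_def)
  have "proper_filter_on (points Y) (filtermap h (inf (nhds p) (principal S)))"
    using assms(2) nhds_within_neq_bot[OF p]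
    by (intro proper_filter_on_filtermap[of h S]) (auto simp: continuous_into_def)
  then have "f (h p) \<in> limits Z (filtermap f (filtermap h (inf (nhds p) (principal S))))"
    using assms p by (simp add: preserves_convergence_def continuous_into_def)
  then show "(f \<circ> h) p \<in> limits Z (filtermap (f \<circ> h) (inf (nhds p) (principal S)))"
    by (simp add: filtermap_filtermap comp_def)
qed

lemma path_homotopic_image:
  assumes "preserves_convergence Y Z f" "path_homotopic Y g k"
  shows "path_homotopic Z (f \<circ> g) (f \<circ> k)"
proof -
  obtain h :: "real \<times> real \<Rightarrow> 'a" where h: "continuous_into ({0..1} \<times> {0..1}) Y h"
    "\<And>t. t \<in> {0..1} \<Longrightarrow> h (0, t) = g t" "\<And>t. t \<in> {0..1} \<Longrightarrow> h (1, t) = k t"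
    "\<And>s. s \<in> {0..1} \<Longrightarrow> h (s, 0) = g 0" "\<And>s. s \<in> {0..1} \<Longrightarrow> h (s, 1) = g 1"
    using assms(2) unfolding path_homotopic_def by blast
  show ?thesis
    by (rule path_homotopicI[OF preserves_convergence_compose[OF assms(1) h(1)]])
      (simp_all add: h(2-))
qed

lemma on_obj_fundamental_groupoid_map [simp]:
  "on_obj (fundamental_groupoid_map Y Z f) = restrict f (points Y)"
  by (simp add: fundamental_groupoid_map_def)

lemma on_arr_fundamental_groupoid_map:
  assumes "limit_space Y" "limit_space Z" "preserves_convergence Y Z f" "continuous_into {0..1} Y g"
  shows "on_arr (fundamental_groupoid_map Y Z f) (homotopy_class Y g) = homotopy_class Z (f \<circ> g)"
proof -
  have "path_class Z (compose {0..1} f \<gamma>) = homotopy_class Z (f \<circ> g)"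
    if "\<gamma> \<in> homotopy_class Y g" for \<gamma>
  proof -
    have "path_homotopic Z (f \<circ> g) (f \<circ> \<gamma>)"
      using that by (intro path_homotopic_image[OF assms(3)]) (auto simp: mem_homotopy_class assms(1))
    then have "homotopy_class Z (f \<circ> g) = homotopy_class Z (f \<circ> \<gamma>)"
      using preserves_convergence_compose[OF assms(3,4)] by (simp add: homotopy_class_eq_iff assms(2))
    then show ?thesis by (simp add: homotopy_class_def compose_def comp_def)
  qed
  then show ?thesis
    using restrict_mem_homotopy_class[OF assms(1,4)] homotopy_class_in_Arr[OF assms(1,4)]
    by (auto simp: fundamental_groupoid_map_def)
qed

lemma is_functor_fundamental_groupoid_map:
  assumes Y: "limit_space Y" and Z: "limit_space Z" and f: "preserves_convergence Y Z f"
  shows "is_functor (fundamental_groupoid Y) (fundamental_groupoid Z) (fundamental_groupoid_map Y Z f)"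
proof -
  note [simp] = on_arr_fundamental_groupoid_map[OF assms] preserves_convergence_compose[OF f]
    homotopy_class_in_Arr Dom_homotopy_class Cod_homotopy_class Comp_homotopy_class assms
    Ident_fundamental_groupoid continuous_into_join continuous_into_points
  show ?thesis
    unfolding is_functor_def
  proof (intro conjI ballI impI)
    show "on_obj (fundamental_groupoid_map Y Z f) \<in>
        Obj (fundamental_groupoid Y) \<rightarrow>\<^sub>E Obj (fundamental_groupoid Z)"
      using f by (auto simp: preserves_convergence_def)
    have "on_arr (fundamental_groupoid_map Y Z f) \<in> extensional (Arr (fundamental_groupoid Y))"
      by (simp add: fundamental_groupoid_map_def)
    moreover have "on_arr (fundamental_groupoid_map Y Z f) c \<in> Arr (fundamental_groupoid Z)"
      if "c \<in> Arr (fundamental_groupoid Y)" for c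
      using that by (rule Arr_fundamental_groupoidE[OF Y]) simp
    ultimately show "on_arr (fundamental_groupoid_map Y Z f) \<in>
        Arr (fundamental_groupoid Y) \<rightarrow>\<^sub>E Arr (fundamental_groupoid Z)"
      by (auto simp: PiE_def)
  next
    fix x assume "x \<in> Obj (fundamental_groupoid Y)"
    then show "on_arr (fundamental_groupoid_map Y Z f) (Ident (fundamental_groupoid Y) x) =
        Ident (fundamental_groupoid Z) (on_obj (fundamental_groupoid_map Y Z f) x)"
      using on_arr_fundamental_groupoid_map[OF assms continuous_into_const[OF Y]]
      by (simp add: comp_def)
  next
    fix c assume "c \<in> Arr (fundamental_groupoid Y)"
    then obtain g where g: "continuous_into {0..1} Y g" "c = homotopy_class Y g"
      by (rule Arr_fundamental_groupoidE[OF Y])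
    then show "Dom (fundamental_groupoid Z) (on_arr (fundamental_groupoid_map Y Z f) c) =
        on_obj (fundamental_groupoid_map Y Z f) (Dom (fundamental_groupoid Y) c)"
      "Cod (fundamental_groupoid Z) (on_arr (fundamental_groupoid_map Y Z f) c) =
        on_obj (fundamental_groupoid_map Y Z f) (Cod (fundamental_groupoid Y) c)"
      by simp_all
    fix d assume "d \<in> Arr (fundamental_groupoid Y)"
    then obtain k where k: "continuous_into {0..1} Y k" "d = homotopy_class Y k"
      by (rule Arr_fundamental_groupoidE[OF Y])
    assume "Dom (fundamental_groupoid Y) d = Cod (fundamental_groupoid Y) c"
    then show "on_arr (fundamental_groupoid_map Y Z f) (Comp (fundamental_groupoid Y) d c) =
        Comp (fundamental_groupoid Z) (on_arr (fundamental_groupoid_map Y Z f) d)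
          (on_arr (fundamental_groupoid_map Y Z f) c)"
      using g k by (simp add: compose_join_paths)
  qed
qed

lemma fundamental_groupoid_map_ident:
  assumes "limit_space X"
  shows "fundamental_groupoid_map X X (\<lambda>x. x) = identity_functor (fundamental_groupoid X)"
proof -
  have id: "preserves_convergence X X (\<lambda>x. x)"
    by (simp add: preserves_convergence_def filtermap_ident)
  have "on_arr (fundamental_groupoid_map X X (\<lambda>x. x)) c = (\<lambda>c\<in>Arr (fundamental_groupoid X). c) c"
    for c
  proof (cases "c \<in> Arr (fundamental_groupoid X)")
    case True
    then obtain g where "continuous_into {0..1} X g" "c = homotopy_class X g"
      by (rule Arr_fundamental_groupoidE[OF assms])
    then show ?thesis
      using True on_arr_fundamental_groupoid_map[OF assms assms id] by (simp add: comp_def)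
  qed (simp add: fundamental_groupoid_map_def)
  then show ?thesis
    by (intro functor_maps.equality) (auto simp: identity_functor_def)
qed

lemma fundamental_groupoid_map_compose:
  assumes X: "limit_space X" and Y: "limit_space Y" and Z: "limit_space Z"
    and f: "preserves_convergence X Y f" and g: "preserves_convergence Y Z g"
  shows "fundamental_groupoid_map X Z (\<lambda>x. g (f x)) =
    compose_functors (fundamental_groupoid X) (fundamental_groupoid_map Y Z g)
      (fundamental_groupoid_map X Y f)"
proof -
  have gf: "preserves_convergence X Z (\<lambda>x. g (f x))"
    unfolding preserves_convergence_def
  proof (intro conjI allI impI)
    fix F x assume F: "proper_filter_on (points X) F" "x \<in> limits X F"
    have "proper_filter_on (points Y) (filtermap f F)"
      using f F by (intro proper_filter_on_filtermap[of f "points X"])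
        (auto simp: preserves_convergence_def proper_filter_on_def)
    then show "g (f x) \<in> limits Z (filtermap (\<lambda>x. g (f x)) F)"
      using F f g unfolding preserves_convergence_def
      by (metis filtermap_filtermap)
  qed (use f g in \<open>auto simp: preserves_convergence_def\<close>)
  have "on_arr (fundamental_groupoid_map X Z (\<lambda>x. g (f x))) c =
      compose (Arr (fundamental_groupoid X)) (on_arr (fundamental_groupoid_map Y Z g))
        (on_arr (fundamental_groupoid_map X Y f)) c" for c
  proof (cases "c \<in> Arr (fundamental_groupoid X)")
    case True
    then obtain k where k: "continuous_into {0..1} X k" "c = homotopy_class X k"
      by (rule Arr_fundamental_groupoidE[OF X])
    then show ?thesis
      using True on_arr_fundamental_groupoid_map[OF X Z gf k(1)]
        on_arr_fundamental_groupoid_map[OF X Y f k(1)]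
        on_arr_fundamental_groupoid_map[OF Y Z g preserves_convergence_compose[OF f k(1)]]
      by (simp add: comp_def compose_eq)
  qed (simp add: fundamental_groupoid_map_def compose_def)
  moreover have "restrict (\<lambda>x. g (f x)) (points X) =
      compose (points X) (restrict g (points Y)) (restrict f (points X))"
    using f by (auto simp: compose_def preserves_convergence_def fun_eq_iff)
  ultimately show ?thesis
    by (intro functor_maps.equality) (auto simp: compose_functors_def)
qed


section \<open>Transport along paths\<close>

lemma linepath_mem:
  assumes "convex K" "a \<in> K" "b \<in> K"
  shows "linepath a b \<in> {0..1} \<rightarrow> K"
  using assms by (auto simp: linepath_def intro!: convexD)

lemma continuous_into_linepath:
  fixes K :: "'b::real_normed_vector set"
  assumes "limit_space X" "convex K" "continuous_into K X h" "a \<in> K" "b \<in> K"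
  shows "continuous_into {0..1} X (h \<circ> linepath a b)"
  using assms by (intro continuous_into_compose[of X K h]) (auto simp: linepath_mem continuous_on_linepath)

lemma linepath_compose_linepath:
  "linepath a b \<circ> linepath p q = linepath (linepath a b p) (linepath a b q)"
proof
  fix t
  show "(linepath a b \<circ> linepath p q) t = linepath (linepath a b p) (linepath a b q) t"
    by (simp add: linepath_def algebra_simps)
qed

lemma dist_linepath_linepath: "dist (linepath a b p) (linepath a b q) = \<bar>p - q\<bar> * dist a b"
proof -
  have "linepath a b p - linepath a b q = (q - p) *\<^sub>R (a - b)"
    by (simp add: linepath_def algebra_simps)
  then show ?thesis by (simp add: dist_norm abs_minus_commute)
qed

text \<open>Inside the convex set \<open>K\<close> the broken line through \<open>y\<close> deforms
  linearly to the straight segment from \<open>x\<close> to \<open>z\<close>. Once mapped by a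
  cocone functor, this is the cocycle identity.\<close>

lemma homotopy_class_triangle:
  fixes K :: "'b::real_normed_vector set"
  assumes "limit_space X" "convex K" "continuous_into K X h" "x \<in> K" "y \<in> K" "z \<in> K"
  shows "homotopy_class X (h \<circ> linepath x z) =
    Comp (fundamental_groupoid X) (homotopy_class X (h \<circ> linepath y z))
      (homotopy_class X (h \<circ> linepath x y))"
proof -
  note line = continuous_into_linepath[OF assms(1-3)]
  have "join_paths (linepath x y) (linepath y z) = linepath x y +++ linepath y z"
    by (simp add: join_paths_def joinpaths_def)
  moreover have "path (linepath x y +++ linepath y z)" by simp
  ultimately have "continuous_on {0..1} (join_paths (linepath x y) (linepath y z))"
    by (simp add: path_def)
  moreover have "join_paths (linepath x y) (linepath y z) \<in> {0..1} \<rightarrow> K"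
    using linepath_mem[OF assms(2,4,5)] linepath_mem[OF assms(2,5,6)]
    by (auto simp: join_paths_def Pi_iff)
  ultimately have "path_homotopic X (h \<circ> linepath x z)
      (h \<circ> join_paths (linepath x y) (linepath y z))"
    using assms by (intro path_homotopic_reparametrize[OF assms(1-3)])
      (auto simp: linepath_mem linepath_0' linepath_1' continuous_on_linepath)
  then have "homotopy_class X (h \<circ> linepath x z) =
      homotopy_class X (join_paths (h \<circ> linepath x y) (h \<circ> linepath y z))"
    using line assms(4-6) by (simp add: homotopy_class_eq_iff[OF assms(1)] compose_join_paths)
  then show ?thesis
    using line assms(4-6) by (simp add: Comp_homotopy_class[OF assms(1)] linepath_0' linepath_1')
qed

lemma preserves_convergence_subspace_conv:
  assumes "U \<subseteq> V"
  shows "preserves_convergence (subspace_conv X U) (subspace_conv X V) (\<lambda>x. x)"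
  using assms by (auto simp: preserves_convergence_def subspace_conv_def filtermap_ident)

lemma preserves_convergence_inclusion:
  assumes "U \<subseteq> points X"
  shows "preserves_convergence (subspace_conv X U) X (\<lambda>x. x)"
  using assms by (auto simp: preserves_convergence_def subspace_conv_def filtermap_ident)

section \<open>Values of a cocone on points and on paths inside members\<close>

locale fundamental_cocone =
  fixes X :: "'a convergence_space" and \<O> :: "'a set set"
    and G :: "('q, 'r) cat"
    and \<psi> :: "'a set \<Rightarrow> ('a, (real \<Rightarrow> 'a) set, 'q, 'r) functor_maps"
  assumes X: "limit_space X"
    and system: "convergence_system X \<O>"
    and inter: "closed_under_finite_intersections \<O>"
    and G: "category G"
    and functor_\<psi>: "U \<in> \<O> \<Longrightarrow> is_functor (fundamental_groupoid (subspace_conv X U)) G (\<psi> U)"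
    and compatible: "\<lbrakk>U \<in> \<O>; V \<in> \<O>; U \<subseteq> V\<rbrakk> \<Longrightarrow>
      compose_functors (fundamental_groupoid (subspace_conv X U)) (\<psi> V)
        (fundamental_groupoid_map (subspace_conv X U) (subspace_conv X V) (\<lambda>x. x)) = \<psi> U"
begin

lemma member_subset: "U \<in> \<O> \<Longrightarrow> U \<subseteq> points X"
  using system by (auto simp: convergence_system_def)

lemma member_limit_space: "U \<in> \<O> \<Longrightarrow> limit_space (subspace_conv X U)"
  by (rule limit_space_subspace_conv[OF X member_subset])

lemma member_Int: "\<lbrakk>U \<in> \<O>; V \<in> \<O>\<rbrakk> \<Longrightarrow> U \<inter> V \<in> \<O>"
  using inter[unfolded closed_under_finite_intersections_def, rule_format, of "{U, V}"] by simp

text \<open>The members cover X: the principal filter at \<open>x\<close> converges to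
  \<open>x\<close> by centredness, and a member of \<open>\<O>\<close> that belongs to it contains
  \<open>x\<close>.\<close>

lemma point_in_member:
  assumes "x \<in> points X"
  obtains U where "U \<in> \<O>" "x \<in> U"
proof -
  have "proper_filter_on (points X) (principal {x})" "x \<in> limits X (principal {x})"
    using assms X by (auto simp: proper_filter_on_def limit_space_def centered_def principal_eq_bot_iff)
  then have "\<exists>U\<in>\<O>. eventually (\<lambda>y. y \<in> U) (principal {x})"
    using system unfolding convergence_system_def by blast
  then show thesis using that by (auto simp: eventually_principal)
qed

lemma
  assumes "U \<in> \<O>" "continuous_into {0..1} X f" "f \<in> {0..1} \<rightarrow> U"
  shows continuous_into_member: "continuous_into {0..1} (subspace_conv X U) f"
    and homotopy_class_member:
      "homotopy_class (subspace_conv X U) f \<in> Arr (fundamental_groupoid (subspace_conv X U))"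
proof -
  show *: "continuous_into {0..1} (subspace_conv X U) f"
    using assms by (simp add: continuous_into_subspace_conv member_subset)
  show "homotopy_class (subspace_conv X U) f \<in> Arr (fundamental_groupoid (subspace_conv X U))"
    by (rule homotopy_class_in_Arr[OF member_limit_space[OF assms(1)] *])
qed

lemma on_obj_subset:
  assumes "U \<in> \<O>" "V \<in> \<O>" "U \<subseteq> V" "x \<in> U"
  shows "on_obj (\<psi> U) x = on_obj (\<psi> V) x"
proof -
  have "on_obj (\<psi> U) x = compose U (on_obj (\<psi> V)) (restrict (\<lambda>x. x) U) x"
    by (subst compatible[OF assms(1-3), symmetric]) (simp add: compose_functors_def)
  then show ?thesis using assms(4) by (simp add: compose_def)
qed

lemma on_arr_subset:
  assumes "U \<in> \<O>" "V \<in> \<O>" "U \<subseteq> V" "continuous_into {0..1} X f" "f \<in> {0..1} \<rightarrow> U"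
  shows "on_arr (\<psi> U) (homotopy_class (subspace_conv X U) f) =
    on_arr (\<psi> V) (homotopy_class (subspace_conv X V) f)"
proof -
  note f = homotopy_class_member[OF assms(1,4,5)]
  have "on_arr (fundamental_groupoid_map (subspace_conv X U) (subspace_conv X V) (\<lambda>x. x))
      (homotopy_class (subspace_conv X U) f) = homotopy_class (subspace_conv X V) f"
    using on_arr_fundamental_groupoid_map[OF member_limit_space[OF assms(1)]
        member_limit_space[OF assms(2)] preserves_convergence_subspace_conv[OF assms(3)]
        continuous_into_member[OF assms(1,4,5)]]
    by (simp add: comp_def)
  then show ?thesis
    by (subst compatible[OF assms(1-3), symmetric])
      (simp add: compose_functors_def compose_eq[OF f])
qed

definition obj :: "'a \<Rightarrow> 'q" where
  "obj x = on_obj (\<psi> (SOME U. U \<in> \<O> \<and> x \<in> U)) x"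

lemma obj_eq:
  assumes "U \<in> \<O>" "x \<in> U"
  shows "obj x = on_obj (\<psi> U) x"
proof -
  let ?V = "SOME U. U \<in> \<O> \<and> x \<in> U"
  have V: "?V \<in> \<O> \<and> x \<in> ?V" by (rule someI) (use assms in blast)
  then have "on_obj (\<psi> (U \<inter> ?V)) x = on_obj (\<psi> U) x" "on_obj (\<psi> (U \<inter> ?V)) x = on_obj (\<psi> ?V) x"
    using assms by (auto intro!: on_obj_subset member_Int)
  then show ?thesis by (simp add: obj_def)
qed

text \<open>Carries meaning only for a path that lies in one member; for other paths the choice is
  arbitrary. For paths in a member, \<open>segment_eq\<close> removes the choice by comparing two
  members in their intersection.\<close>

definition segment :: "(real \<Rightarrow> 'a) \<Rightarrow> 'r" where
  "segment f = (let U = SOME U. U \<in> \<O> \<and> f \<in> {0..1} \<rightarrow> U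
    in on_arr (\<psi> U) (homotopy_class (subspace_conv X U) f))"

lemma segment_eq:
  assumes "U \<in> \<O>" "continuous_into {0..1} X f" "f \<in> {0..1} \<rightarrow> U"
  shows "segment f = on_arr (\<psi> U) (homotopy_class (subspace_conv X U) f)"
proof -
  define V where "V = (SOME U. U \<in> \<O> \<and> f \<in> {0..1} \<rightarrow> U)"
  have V: "V \<in> \<O> \<and> f \<in> {0..1} \<rightarrow> V" unfolding V_def by (rule someI) (use assms in blast)
  then have W: "U \<inter> V \<in> \<O>" "f \<in> {0..1} \<rightarrow> U \<inter> V" using assms by (auto intro: member_Int)
  have "on_arr (\<psi> (U \<inter> V)) (homotopy_class (subspace_conv X (U \<inter> V)) f) =
      on_arr (\<psi> U) (homotopy_class (subspace_conv X U) f)"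
    "on_arr (\<psi> (U \<inter> V)) (homotopy_class (subspace_conv X (U \<inter> V)) f) =
      on_arr (\<psi> V) (homotopy_class (subspace_conv X V) f)"
    using W assms V by (auto intro!: on_arr_subset)
  then show ?thesis by (simp add: segment_def Let_def flip: V_def)
qed

text \<open>The predicates under the choice operator coincide for \<open>f\<close> and
  \<open>g\<close>, so the same set is chosen even when no member contains the path.
  \<open>primitive_cong\<close> relies on this, as a primitive records no members for its
  segments.\<close>

lemma segment_cong:
  assumes "\<And>t. t \<in> {0..1} \<Longrightarrow> f t = g t"
  shows "segment f = segment g"
proof -
  have "f \<in> {0..1} \<rightarrow> U \<longleftrightarrow> g \<in> {0..1} \<rightarrow> U" for U using assms by (auto simp: Pi_iff)
  moreover have "homotopy_class Y f = homotopy_class Y g" for Y by (rule homotopy_class_cong[OF assms])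
  ultimately show ?thesis by (simp add: segment_def)
qed

lemma segment_arrow:
  assumes "U \<in> \<O>" "continuous_into {0..1} X f" "f \<in> {0..1} \<rightarrow> U"
  shows "segment f \<in> Arr G" "Dom G (segment f) = obj (f 0)" "Cod G (segment f) = obj (f 1)"
proof -
  note f = continuous_into_member[OF assms] and c = homotopy_class_member[OF assms]
  note F = functor_\<psi>[OF assms(1), unfolded is_functor_def] and U = member_limit_space[OF assms(1)]
  have "f 0 \<in> U" "f 1 \<in> U" using assms(3) by auto
  then show "segment f \<in> Arr G" "Dom G (segment f) = obj (f 0)" "Cod G (segment f) = obj (f 1)"
    using F c Dom_homotopy_class[OF U f] Cod_homotopy_class[OF U f]
    by (auto simp: segment_eq[OF assms] obj_eq[OF assms(1)])
qed

lemma obj_in_Obj: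
  assumes "x \<in> points X"
  shows "obj x \<in> Obj G"
proof -
  obtain U where U: "U \<in> \<O>" "x \<in> U" by (rule point_in_member[OF assms])
  have "on_obj (\<psi> U) \<in> U \<rightarrow>\<^sub>E Obj G"
    using functor_\<psi>[OF U(1)] by (simp add: is_functor_def)
  then show ?thesis using U(2) unfolding obj_eq[OF U] by (rule PiE_mem)
qed

lemma segment_const:
  assumes "x \<in> points X"
  shows "segment (\<lambda>_. x) = Ident G (obj x)"
proof -
  obtain U where U: "U \<in> \<O>" "x \<in> U" by (rule point_in_member[OF assms])
  then show ?thesis
    using segment_eq[OF U(1) continuous_into_const[OF X assms]] functor_\<psi>[OF U(1)]
    by (simp add: is_functor_def obj_eq Ident_fundamental_groupoid)
qed

text \<open>Since \<open>h\<close> maps \<open>K\<close> into one member \<open>U\<close>, the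
  identity already holds in the fundamental groupoid of \<open>U\<close>, and the functor
  \<open>\<psi> U\<close> carries it to \<open>G\<close>.\<close>

lemma segment_triangle:
  fixes K :: "'b::real_normed_vector set"
  assumes "U \<in> \<O>" "convex K" "continuous_into K X h" "h \<in> K \<rightarrow> U" "x \<in> K" "y \<in> K" "z \<in> K"
  shows "segment (h \<circ> linepath x z) =
    Comp G (segment (h \<circ> linepath y z)) (segment (h \<circ> linepath x y))"
proof -
  note U = member_limit_space[OF assms(1)]
  have h: "continuous_into K (subspace_conv X U) h"
    using assms by (simp add: continuous_into_subspace_conv member_subset)
  have line: "continuous_into {0..1} (subspace_conv X U) (h \<circ> linepath a b)"
    "homotopy_class (subspace_conv X U) (h \<circ> linepath a b)
      \<in> Arr (fundamental_groupoid (subspace_conv X U))"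
    "segment (h \<circ> linepath a b) = on_arr (\<psi> U) (homotopy_class (subspace_conv X U) (h \<circ> linepath a b))"
    if "a \<in> K" "b \<in> K" for a b
  proof -
    have "continuous_into {0..1} X (h \<circ> linepath a b)"
      by (rule continuous_into_linepath[OF X assms(2,3) that])
    moreover have "h \<circ> linepath a b \<in> {0..1} \<rightarrow> U"
      using linepath_mem[OF assms(2) that] assms(4) by auto
    ultimately show "continuous_into {0..1} (subspace_conv X U) (h \<circ> linepath a b)"
      "homotopy_class (subspace_conv X U) (h \<circ> linepath a b)
        \<in> Arr (fundamental_groupoid (subspace_conv X U))"
      "segment (h \<circ> linepath a b) =
        on_arr (\<psi> U) (homotopy_class (subspace_conv X U) (h \<circ> linepath a b))"
      using assms(1) by (auto intro: continuous_into_member homotopy_class_member segment_eq)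
  qed
  have "Dom (fundamental_groupoid (subspace_conv X U)) (homotopy_class (subspace_conv X U) (h \<circ> linepath y z)) =
      Cod (fundamental_groupoid (subspace_conv X U)) (homotopy_class (subspace_conv X U) (h \<circ> linepath x y))"
    using line(1) assms(5-7) by (simp add: Dom_homotopy_class[OF U] Cod_homotopy_class[OF U]
        linepath_0' linepath_1')
  then show ?thesis
    using functor_\<psi>[OF assms(1)] line(2,3) assms(5-7)
    by (simp add: homotopy_class_triangle[OF U assms(2) h assms(5-7)] is_functor_def)
qed

section \<open>Lebesgue numbers and primitives\<close>

text \<open>The cover consists of open sets of the domain on whose trace on \<open>K\<close> the
  function \<open>h\<close> stays in one member. It reaches every \<open>p\<close> in
  \<open>K\<close> because the image of the neighbourhood filter of \<open>p\<close> converges to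
  \<open>h p\<close> and hence contains a member.\<close>

lemma Lebesgue_number_members:
  fixes K :: "'b::metric_space set"
  assumes "compact K" "continuous_into K X h"
  obtains \<epsilon> where "\<epsilon> > 0" "\<And>p. p \<in> K \<Longrightarrow> \<exists>U\<in>\<O>. h \<in> K \<inter> ball p \<epsilon> \<rightarrow> U"
proof -
  define \<G> where "\<G> = {V. open V \<and> (\<exists>U\<in>\<O>. h \<in> K \<inter> V \<rightarrow> U)}"
  have "\<exists>V\<in>\<G>. p \<in> V" if p: "p \<in> K" for p
  proof -
    let ?F = "filtermap h (inf (nhds p) (principal K))"
    have "proper_filter_on (points X) ?F"
      using proper_filter_on_filtermap[OF _ nhds_within_neq_bot[OF p], of h K] assms(2)
      by (auto simp: continuous_into_def)
    moreover have "h p \<in> limits X ?F" using assms(2) p by (simp add: continuous_into_def)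
    ultimately obtain U where "U \<in> \<O>" "eventually (\<lambda>y. y \<in> U) ?F"
      using system unfolding convergence_system_def by blast
    then obtain V where "open V" "p \<in> V" "\<forall>x\<in>V. x \<in> K \<longrightarrow> h x \<in> U"
      by (auto simp: eventually_filtermap eventually_inf_principal eventually_nhds)
    then show ?thesis using \<open>U \<in> \<O>\<close> by (intro bexI[of _ V]) (auto simp: \<G>_def)
  qed
  then have "K \<subseteq> \<Union>\<G>" by blast
  moreover have "open V" if "V \<in> \<G>" for V using that by (simp add: \<G>_def)
  ultimately obtain \<epsilon> where "\<epsilon> > 0"
    and \<epsilon>: "\<And>p. p \<in> K \<Longrightarrow> \<exists>V\<in>\<G>. ball p \<epsilon> \<subseteq> V"
    by (metis Heine_Borel_lemma[OF assms(1)])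
  show thesis
  proof (rule that[OF \<open>\<epsilon> > 0\<close>])
    fix p assume p: "p \<in> K"
    obtain V where "ball p \<epsilon> \<subseteq> V" "V \<in> \<G>" using \<epsilon>[OF p] by blast
    then obtain U where "U \<in> \<O>" "h \<in> K \<inter> V \<rightarrow> U" by (auto simp: \<G>_def)
    then show "\<exists>U\<in>\<O>. h \<in> K \<inter> ball p \<epsilon> \<rightarrow> U"
      using \<open>ball p \<epsilon> \<subseteq> V\<close> by (intro bexI[of _ U]) auto
  qed
qed

text \<open>
  A primitive of \<open>h\<close> is a function whose increments along short segments are the arrows that the
  cocone assigns to the images of these segments under \<open>h\<close>.
\<close>

definition primitive ::
    "'b::real_normed_vector set \<Rightarrow> ('b \<Rightarrow> 'a) \<Rightarrow> 'q \<Rightarrow> ('b \<Rightarrow> 'r) \<Rightarrow> bool" where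
  "primitive K h x f \<longleftrightarrow>
     (\<forall>p\<in>K. f p \<in> Arr G \<and> Dom G (f p) = x \<and> Cod G (f p) = obj (h p)) \<and>
     (\<exists>\<delta>>0. \<forall>p\<in>K. \<forall>q\<in>K. dist p q < \<delta> \<longrightarrow> f q = Comp G (segment (h \<circ> linepath p q)) (f p))"

lemma arrow_laws:
  assumes "f \<in> Arr G"
  shows "Comp G f (Ident G (Dom G f)) = f" "Comp G (Ident G (Cod G f)) f = f"
    "\<lbrakk>g \<in> Arr G; Dom G g = Cod G f\<rbrakk> \<Longrightarrow> Comp G g f \<in> Arr G"
    "\<lbrakk>g \<in> Arr G; Dom G g = Cod G f\<rbrakk> \<Longrightarrow> Dom G (Comp G g f) = Dom G f"
    "\<lbrakk>g \<in> Arr G; Dom G g = Cod G f\<rbrakk> \<Longrightarrow> Cod G (Comp G g f) = Cod G g"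
    "\<lbrakk>g \<in> Arr G; h \<in> Arr G; Dom G g = Cod G f; Dom G h = Cod G g\<rbrakk> \<Longrightarrow>
      Comp G h (Comp G g f) = Comp G (Comp G h g) f"
  using assms G unfolding category_def by blast+

lemma Ident_laws:
  assumes "x \<in> Obj G"
  shows "Ident G x \<in> Arr G" "Dom G (Ident G x) = x" "Cod G (Ident G x) = x"
  using assms G unfolding category_def by blast+

text \<open>
  The primitive is the product of the increments along a subdivision of the segment from \<open>0\<close>, the
  same number of subdivision points being used for all end points.
\<close>

lemma primitive_exists:
  fixes K :: "'b::real_normed_vector set"
  assumes "compact K" "convex K" "0 \<in> K" "continuous_into K X h"
    and a: "a \<in> Arr G" "Cod G a = obj (h 0)"
  obtains f where "primitive K h (Dom G a) f" "f 0 = a"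
proof -
  obtain \<epsilon> where "\<epsilon> > 0" and \<epsilon>: "\<And>p. p \<in> K \<Longrightarrow> \<exists>U\<in>\<O>. h \<in> K \<inter> ball p \<epsilon> \<rightarrow> U"
    using Lebesgue_number_members[OF assms(1,4)] by blast
  \<comment> \<open>Half of the Lebesgue number: the induction below handles quadrilaterals with
    sides shorter than \<open>\<delta>\<close>, and the corner opposite to the centre of the ball is
    up to two sides away.\<close>
  define \<delta> where "\<delta> = \<epsilon> / 2"
  have "\<delta> > 0" using \<open>\<epsilon> > 0\<close> by (simp add: \<delta>_def)
  obtain M where M: "\<And>p. p \<in> K \<Longrightarrow> norm p \<le> M"
    using compact_imp_bounded[OF assms(1)] by (auto simp: bounded_iff)
  \<comment> \<open>With this \<open>n\<close> the pieces of the segment from 0 to \<open>p\<close>,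
    of length \<open>norm p / n\<close>, are shorter than \<open>\<delta>\<close> for all
    \<open>p\<close> in \<open>K\<close> at once. A common \<open>n\<close> is what lets
    neighbouring subdivisions be compared piece by piece.\<close>
  obtain n :: nat where n: "M / \<delta> < real n" using reals_Archimedean2 by blast
  have "M \<ge> 0" using M[OF assms(3)] by simp
  then have "M / \<delta> \<ge> 0" using \<open>\<delta> > 0\<close> by simp
  then have "n > 0" using n by (cases n) auto
  define k :: "nat \<Rightarrow> 'b \<Rightarrow> 'b" where "k = (\<lambda>i p. (real i / real n) *\<^sub>R p)"
  have k_simps: "k 0 p = 0" "k i 0 = 0" "k n p = p" for i p
    using \<open>n > 0\<close> by (simp_all add: k_def)
  \<comment> \<open>\<open>c i p\<close> is \<open>a\<close> followed by the increments along the
    first \<open>i\<close> pieces of the segment from 0 to \<open>p\<close>; the primitive will be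
    \<open>c n\<close>.\<close>
  define c where "c = rec_nat (\<lambda>p. a)
    (\<lambda>i r p. Comp G (segment (h \<circ> linepath (k i p) (k (Suc i) p))) (r p))"
  have c0: "c 0 p = a"
    and cSuc: "c (Suc i) p = Comp G (segment (h \<circ> linepath (k i p) (k (Suc i) p))) (c i p)"
    for i p by (simp_all add: c_def)
  have kK: "k i p \<in> K" if "p \<in> K" "i \<le> n" for i p
    using convexD[OF assms(2) that(1) assms(3), of "real i / real n" "1 - real i / real n"]
      that(2) \<open>n > 0\<close> by (simp add: k_def)
  have kdist: "dist (k i p) (k i q) \<le> dist p q" if "i \<le> n" for i and p q :: 'b
  proof -
    have "dist (k i p) (k i q) = real i / real n * dist p q"
      unfolding k_def dist_norm scaleR_diff_right[symmetric] norm_scaleR by simp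
    also have "\<dots> \<le> 1 * dist p q"
      using that \<open>n > 0\<close> by (intro mult_right_mono) auto
    finally show ?thesis by simp
  qed
  have kstep: "dist (k i p) (k (Suc i) p) < \<delta>" if "p \<in> K" for i p
  proof -
    have diff: "k (Suc i) p - k i p = (1 / real n) *\<^sub>R p"
      by (simp add: k_def add_divide_distrib flip: scaleR_diff_left)
    have "dist (k i p) (k (Suc i) p) = norm (k (Suc i) p - k i p)"
      by (simp only: dist_norm norm_minus_commute)
    also have "\<dots> = norm p / real n" unfolding diff by simp
    also have "\<dots> \<le> M / real n" using M[OF that] by (simp add: divide_right_mono)
    also have "\<dots> < \<delta>" using n \<open>n > 0\<close> \<open>\<delta> > 0\<close> by (simp add: field_simps)
    finally show ?thesis .
  qed
  have tri: "segment (h \<circ> linepath x z) =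
      Comp G (segment (h \<circ> linepath y z)) (segment (h \<circ> linepath x y))"
    if w: "w \<in> K" and xyz: "x \<in> K \<inter> ball w \<epsilon>" "y \<in> K \<inter> ball w \<epsilon>" "z \<in> K \<inter> ball w \<epsilon>" for w x y z
  proof -
    obtain U where "U \<in> \<O>" "h \<in> K \<inter> ball w \<epsilon> \<rightarrow> U" using \<epsilon>[OF w] by blast
    then show ?thesis
      using xyz assms(2) by (intro segment_triangle[of U "K \<inter> ball w \<epsilon>"])
        (auto intro: continuous_into_subset[OF X assms(4)] convex_Int)
  qed
  have arr: "segment (h \<circ> linepath x y) \<in> Arr G" "Dom G (segment (h \<circ> linepath x y)) = obj (h x)"
      "Cod G (segment (h \<circ> linepath x y)) = obj (h y)"
    if xy: "x \<in> K" "y \<in> K" "dist x y < \<epsilon>" for x y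
  proof -
    obtain U where U: "U \<in> \<O>" "h \<in> K \<inter> ball x \<epsilon> \<rightarrow> U" using \<epsilon>[OF xy(1)] by blast
    have "linepath x y \<in> {0..1} \<rightarrow> K \<inter> ball x \<epsilon>"
      using xy assms(2) \<open>\<epsilon> > 0\<close> by (intro linepath_mem convex_Int) auto
    then have "h \<circ> linepath x y \<in> {0..1} \<rightarrow> U" using U(2) by auto
    from segment_arrow[OF U(1) continuous_into_linepath[OF X assms(2,4) xy(1,2)] this]
    show "segment (h \<circ> linepath x y) \<in> Arr G" "Dom G (segment (h \<circ> linepath x y)) = obj (h x)"
      "Cod G (segment (h \<circ> linepath x y)) = obj (h y)"
      by (simp_all add: linepath_0' linepath_1')
  qed
  have \<delta>\<epsilon>: "\<delta> < \<epsilon>" using \<open>\<epsilon> > 0\<close> by (simp add: \<delta>_def)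
  have carr: "c i p \<in> Arr G \<and> Dom G (c i p) = Dom G a \<and> Cod G (c i p) = obj (h (k i p))"
    if p: "p \<in> K" and "i \<le> n" for i p
    using \<open>i \<le> n\<close>
  proof (induction i)
    case 0
    then show ?case using a by (simp add: c0 k_simps)
  next
    case (Suc i)
    have "dist (k i p) (k (Suc i) p) < \<epsilon>" using kstep[OF p, of i] \<delta>\<epsilon> by linarith
    note arr[OF kK[OF p] kK[OF p] this]
    then show ?case using Suc unfolding cSuc by (simp add: arrow_laws)
  qed
  have seg0: "segment (\<lambda>_. h 0) = Ident G (obj (h 0))"
    by (rule segment_const[OF continuous_into_points[OF assms(4,3)]])
  \<comment> \<open>A ladder argument: the rungs join \<open>k i p\<close> to \<open>k i q\<close>.
    In the induction step the cell between two rungs is cut by the diagonal from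
    \<open>k i p\<close> to \<open>k (Suc i) q\<close>, and the triangle identity is used once on
    either side of the diagonal. All four corners lie in the ball about \<open>k i p\<close>, so one
    member serves both triangles.\<close>
  have step: "c i q = Comp G (segment (h \<circ> linepath (k i p) (k i q))) (c i p)"
    if p: "p \<in> K" and q: "q \<in> K" and pq: "dist p q < \<delta>" and "i \<le> n" for i p q
    using \<open>i \<le> n\<close>
  proof (induction i)
    case 0
    show ?case using a arrow_laws(2)[OF a(1)] by (simp add: c0 k_simps comp_def linepath_refl seg0)
  next
    case (Suc i)
    let ?P = "k i p" and ?P' = "k (Suc i) p" and ?Q = "k i q" and ?Q' = "k (Suc i) q"
    have K: "?P \<in> K" "?P' \<in> K" "?Q \<in> K" "?Q' \<in> K" using kK p q Suc.prems by auto
    have PQ: "dist ?P ?Q < \<delta>" "dist ?P' ?Q' < \<delta>"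
      using kdist[of i p q] kdist[of "Suc i" p q] Suc.prems pq by linarith+
    note steps = kstep[OF p, of i] kstep[OF q, of i]
    have "dist ?P ?Q' < \<epsilon>"
      using dist_triangle[of ?P ?Q' ?Q] PQ(1) steps(2) by (simp add: \<delta>_def)
    then have ball: "?P \<in> K \<inter> ball ?P \<epsilon>" "?P' \<in> K \<inter> ball ?P \<epsilon>" "?Q \<in> K \<inter> ball ?P \<epsilon>"
        "?Q' \<in> K \<inter> ball ?P \<epsilon>"
      using K PQ(1) steps(1) \<delta>\<epsilon> \<open>\<epsilon> > 0\<close> by auto
    note arrs = arr[OF K(1,3) less_trans[OF PQ(1) \<delta>\<epsilon>]] arr[OF K(2,4) less_trans[OF PQ(2) \<delta>\<epsilon>]]
      arr[OF K(1,2) less_trans[OF steps(1) \<delta>\<epsilon>]] arr[OF K(3,4) less_trans[OF steps(2) \<delta>\<epsilon>]]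
    have cp: "c i p \<in> Arr G" "Cod G (c i p) = obj (h ?P)" using carr[OF p, of i] Suc.prems by auto
    have "c (Suc i) q = Comp G (segment (h \<circ> linepath ?Q ?Q'))
        (Comp G (segment (h \<circ> linepath ?P ?Q)) (c i p))"
      using Suc by (simp only: cSuc Suc_leD)
    also have "\<dots> = Comp G (segment (h \<circ> linepath ?P ?Q')) (c i p)"
      unfolding tri[OF K(1) ball(1,3,4)] using arrs cp by (simp add: arrow_laws)
    also have "\<dots> = Comp G (segment (h \<circ> linepath ?P' ?Q'))
        (Comp G (segment (h \<circ> linepath ?P ?P')) (c i p))"
      unfolding tri[OF K(1) ball(1,2,4)] using arrs cp by (simp add: arrow_laws)
    also have "\<dots> = Comp G (segment (h \<circ> linepath ?P' ?Q')) (c (Suc i) p)"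
      by (simp only: cSuc)
    finally show ?case .
  qed
  have "primitive K h (Dom G a) (c n)"
    unfolding primitive_def
  proof (intro conjI exI[of _ \<delta>] ballI impI)
    fix p q assume "p \<in> K" "q \<in> K" "dist p q < \<delta>"
    then show "c n q = Comp G (segment (h \<circ> linepath p q)) (c n p)"
      using step[of p q n] by (simp add: k_simps)
  qed (use carr[of _ n] \<open>\<delta> > 0\<close> in \<open>auto simp: k_simps\<close>)
  \<comment> \<open>At the point 0 all subdivision points coincide, so every increment is the
    identity of a constant path.\<close>
  moreover have "c i 0 = a" for i
  proof (induction i)
    case (Suc i)
    then show ?case using a arrow_laws(2)[OF a(1)] by (simp add: cSuc k_simps comp_def linepath_refl seg0)
  qed (simp add: c0)
  ultimately show thesis by (rule that)
qed

lemma primitive_linepath: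
  assumes "convex K" "primitive K h x f" "a \<in> K" "b \<in> K"
  shows "primitive {0..1} (h \<circ> linepath a b) x (f \<circ> linepath a b)"
proof -
  have K: "linepath a b t \<in> K" if "t \<in> {0..1}" for t using linepath_mem[OF assms(1,3,4)] that by blast
  obtain \<delta> where "\<delta> > 0" and \<delta>: "\<And>p q. p \<in> K \<Longrightarrow> q \<in> K \<Longrightarrow> dist p q < \<delta> \<Longrightarrow>
      f q = Comp G (segment (h \<circ> linepath p q)) (f p)"
    using assms(2) unfolding primitive_def by blast
  have pos: "1 + dist a b > 0" by (simp add: add_pos_nonneg)
  show ?thesis
    unfolding primitive_def
  \<comment> \<open>The line path stretches distances by the factor \<open>dist a b\<close>; adding
    1 keeps the quotient defined when \<open>a = b\<close>.\<close>
  proof (intro conjI exI[of _ "\<delta> / (1 + dist a b)"] ballI impI)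
    fix p q :: real assume p: "p \<in> {0..1}" and q: "q \<in> {0..1}" and "dist p q < \<delta> / (1 + dist a b)"
    then have "\<bar>p - q\<bar> * (1 + dist a b) < \<delta>" using pos by (simp add: dist_real_def pos_less_divide_eq)
    then have "dist (linepath a b p) (linepath a b q) < \<delta>"
      using abs_ge_zero[of "p - q"] unfolding dist_linepath_linepath
      by (simp add: distrib_left)
    from \<delta>[OF K[OF p] K[OF q] this]
    show "(f \<circ> linepath a b) q =
        Comp G (segment (h \<circ> linepath a b \<circ> linepath p q)) ((f \<circ> linepath a b) p)"
      by (simp add: comp_assoc linepath_compose_linepath)
  qed (use assms(2) K \<open>\<delta> > 0\<close> pos in \<open>auto simp: primitive_def\<close>)
qed

text \<open>On a subdivision finer than both moduli the two primitives obey the same recursion, so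
  they agree at every subdivision point, the last of which is 1. Taking \<open>Suc n\<close> pieces
  keeps the mesh well defined.\<close>

lemma primitive_unique:
  assumes "primitive {0..1} h x f" "primitive {0..1} h x g" "f 0 = g 0"
  shows "f (1::real) = g 1"
proof -
  obtain \<delta>1 where "\<delta>1 > 0" and \<delta>1: "\<And>p q. p \<in> {0..1} \<Longrightarrow> q \<in> {0..1} \<Longrightarrow> dist p q < \<delta>1 \<Longrightarrow>
      f q = Comp G (segment (h \<circ> linepath p q)) (f p)"
    using assms(1) unfolding primitive_def by blast
  obtain \<delta>2 where "\<delta>2 > 0" and \<delta>2: "\<And>p q. p \<in> {0..1} \<Longrightarrow> q \<in> {0..1} \<Longrightarrow> dist p q < \<delta>2 \<Longrightarrow>
      g q = Comp G (segment (h \<circ> linepath p q)) (g p)"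
    using assms(2) unfolding primitive_def by blast
  obtain n where n: "inverse (real (Suc n)) < min \<delta>1 \<delta>2"
    using reals_Archimedean[of "min \<delta>1 \<delta>2"] \<open>\<delta>1 > 0\<close> \<open>\<delta>2 > 0\<close> by auto
  have "f (real i / real (Suc n)) = g (real i / real (Suc n))" if "i \<le> Suc n" for i
    using that
  proof (induction i)
    case 0
    then show ?case using assms(3) by simp
  next
    case (Suc i)
    let ?p = "real i / real (Suc n)" and ?q = "real (Suc i) / real (Suc n)"
    have pq: "?p \<in> {0..1}" "?q \<in> {0..1}" using Suc.prems by auto
    have step: "?q - ?p = inverse (real (Suc n))"
      by (simp add: diff_divide_distrib[symmetric] inverse_eq_divide)
    have "dist ?p ?q = \<bar>?q - ?p\<bar>" by (simp only: dist_real_def abs_minus_commute)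
    then have "dist ?p ?q = inverse (real (Suc n))" unfolding step by simp
    then have "dist ?p ?q < \<delta>1" "dist ?p ?q < \<delta>2" using n by simp_all
    then show ?case
      using \<delta>1[OF pq] \<delta>2[OF pq] Suc by simp
  qed
  from this[of "Suc n"] show ?thesis by simp
qed

lemma primitive_cong:
  assumes "primitive {0..1::real} h x f" "\<And>t. t \<in> {0..1} \<Longrightarrow> h' t = h t"
  shows "primitive {0..1::real} h' x f"
proof -
  have "segment (h' \<circ> linepath p q) = segment (h \<circ> linepath p q)"
    if "p \<in> {0..1}" "q \<in> {0..1}" for p q :: real
    using linepath_mem[of "{0..1}" p q] that assms(2) by (intro segment_cong) (auto simp: Pi_iff)
  then show ?thesis using assms unfolding primitive_def by simp
qed

text \<open>Precomposing with \<open>a\<close> changes the initial value of a primitive without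
  changing its increments. This brings an arbitrary primitive to the comparison with a normalized
  one.\<close>

lemma primitive_translate:
  assumes "primitive {0..1::real} h x f" "continuous_into {0..1} X h" "a \<in> Arr G" "Cod G a = x"
  shows "primitive {0..1} h (Dom G a) (\<lambda>t. Comp G (f t) a)"
proof -
  obtain \<delta> where "\<delta> > 0" and \<delta>: "\<And>p q. p \<in> {0..1} \<Longrightarrow> q \<in> {0..1} \<Longrightarrow> dist p q < \<delta> \<Longrightarrow>
      f q = Comp G (segment (h \<circ> linepath p q)) (f p)"
    using assms(1) unfolding primitive_def by blast
  \<comment> \<open>The definition of \<open>primitive\<close> does not say that increments are
    composable arrows. Below the Lebesgue number they are, which is what associativity requires;
    hence the modulus \<open>min \<delta> \<epsilon>\<close>.\<close>
  obtain \<epsilon> where "\<epsilon> > 0" and \<epsilon>: "\<And>p. p \<in> {0..1} \<Longrightarrow> \<exists>U\<in>\<O>. h \<in> {0..1} \<inter> ball p \<epsilon> \<rightarrow> U"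
    using Lebesgue_number_members[OF compact_Icc assms(2)] by blast
  have f: "\<And>p. p \<in> {0..1} \<Longrightarrow> f p \<in> Arr G \<and> Dom G (f p) = x \<and> Cod G (f p) = obj (h p)"
    using assms(1) unfolding primitive_def by blast
  show ?thesis
    unfolding primitive_def
  proof (intro conjI exI[of _ "min \<delta> \<epsilon>"] ballI impI)
    fix p q :: real assume p: "p \<in> {0..1}" and q: "q \<in> {0..1}" and pq: "dist p q < min \<delta> \<epsilon>"
    obtain U where U: "U \<in> \<O>" "h \<in> {0..1} \<inter> ball p \<epsilon> \<rightarrow> U" using \<epsilon>[OF p] by blast
    have "linepath p q \<in> {0..1} \<rightarrow> {0..1} \<inter> ball p \<epsilon>"
      using p q pq \<open>\<epsilon> > 0\<close> by (intro linepath_mem convex_Int) auto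
    then have "h \<circ> linepath p q \<in> {0..1} \<rightarrow> U" using U(2) by auto
    from segment_arrow[OF U(1) continuous_into_linepath[OF X _ assms(2) p q] this]
    show "Comp G (f q) a = Comp G (segment (h \<circ> linepath p q)) (Comp G (f p) a)"
      using \<delta>[OF p q] pq f[OF p] assms(3,4) by (simp add: arrow_laws linepath_0')
  qed (use f assms(3,4) \<open>\<delta> > 0\<close> \<open>\<epsilon> > 0\<close> in \<open>auto simp: arrow_laws\<close>)
qed

section \<open>Transport along paths and its homotopy invariance\<close>

definition transport :: "(real \<Rightarrow> 'a) \<Rightarrow> 'r" where
  "transport \<gamma> = (SOME v. \<exists>f. primitive {0..1} \<gamma> (obj (\<gamma> 0)) f \<and> f 0 = Ident G (obj (\<gamma> 0)) \<and> v = f 1)"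

lemma transport_eq:
  assumes "primitive {0..1} \<gamma> (obj (\<gamma> 0)) f" "f 0 = Ident G (obj (\<gamma> 0))"
  shows "transport \<gamma> = f 1"
proof -
  let ?P = "\<lambda>v. \<exists>f. primitive {0..1} \<gamma> (obj (\<gamma> 0)) f \<and> f 0 = Ident G (obj (\<gamma> 0)) \<and> v = f 1"
  have "?P (transport \<gamma>)" unfolding transport_def by (rule someI[of ?P "f 1"]) (use assms in blast)
  then obtain g where g: "primitive {0..1} \<gamma> (obj (\<gamma> 0)) g" "g 0 = Ident G (obj (\<gamma> 0))"
    "transport \<gamma> = g 1" by blast
  then show ?thesis using primitive_unique[OF g(1) assms(1)] assms(2) by simp
qed

lemma normalized_primitive_exists:
  fixes K :: "'b::real_normed_vector set"
  assumes "compact K" "convex K" "0 \<in> K" "continuous_into K X h"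
  obtains f where "primitive K h (obj (h 0)) f" "f 0 = Ident G (obj (h 0))"
proof -
  note id = Ident_laws[OF obj_in_Obj[OF continuous_into_points[OF assms(4,3)]]]
  show thesis
    using primitive_exists[OF assms id(1,3)] that unfolding id(2) by blast
qed

lemma transport_arrow:
  assumes "continuous_into {0..1} X \<gamma>"
  shows "transport \<gamma> \<in> Arr G" "Dom G (transport \<gamma>) = obj (\<gamma> 0)" "Cod G (transport \<gamma>) = obj (\<gamma> 1)"
proof -
  obtain f where f: "primitive {0..1} \<gamma> (obj (\<gamma> 0)) f" "f 0 = Ident G (obj (\<gamma> 0))"
    using normalized_primitive_exists[OF compact_Icc _ _ assms] by auto
  then show "transport \<gamma> \<in> Arr G" "Dom G (transport \<gamma>) = obj (\<gamma> 0)" "Cod G (transport \<gamma>) = obj (\<gamma> 1)"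
    unfolding transport_eq[OF f] by (auto simp: primitive_def)
qed

lemma transport_cong:
  assumes "\<And>t. t \<in> {0..1} \<Longrightarrow> \<gamma> t = \<gamma>' t" "continuous_into {0..1} X \<gamma>"
  shows "transport \<gamma> = transport \<gamma>'"
proof -
  obtain f where f: "primitive {0..1} \<gamma> (obj (\<gamma> 0)) f" "f 0 = Ident G (obj (\<gamma> 0))"
    using normalized_primitive_exists[OF compact_Icc _ _ assms(2)] by auto
  have "primitive {0..1} \<gamma>' (obj (\<gamma>' 0)) f" "f 0 = Ident G (obj (\<gamma>' 0))"
    using primitive_cong[OF f(1), of \<gamma>'] f(2) assms(1)[of 0] assms(1) by simp_all
  then show ?thesis using transport_eq[OF f] transport_eq[of \<gamma>' f] by simp
qed

text \<open>The normalized primitive translated by \<open>f 0\<close> starts at the same arrow as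
  \<open>f\<close>, so by uniqueness both end at the same arrow.\<close>

lemma primitive_transport:
  assumes "primitive {0..1} \<gamma> x f" "continuous_into {0..1} X \<gamma>"
  shows "f 1 = Comp G (transport \<gamma>) (f 0)"
proof -
  obtain g where g: "primitive {0..1} \<gamma> (obj (\<gamma> 0)) g" "g 0 = Ident G (obj (\<gamma> 0))"
    using normalized_primitive_exists[OF compact_Icc _ _ assms(2)] by auto
  have f0: "f 0 \<in> Arr G" "Dom G (f 0) = x" "Cod G (f 0) = obj (\<gamma> 0)"
    using assms(1) by (auto simp: primitive_def)
  have "Comp G (g 0) (f 0) = f 0" using g(2) f0 arrow_laws(2)[of "f 0"] by simp
  then show ?thesis
    using primitive_unique[OF assms(1), of "\<lambda>t. Comp G (g t) (f 0)"]
      primitive_translate[OF g(1) assms(2) f0(1,3)] f0(2) transport_eq[OF g] by simp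
qed

text \<open>The increment rule for segments of any length, with \<open>transport\<close> in place of
  \<open>segment\<close>. It is used to read a primitive off at the midpoint of an interval and at
  the corners of a square.\<close>

lemma primitive_linepath_transport:
  assumes "primitive K h x f" "convex K" "continuous_into K X h" "a \<in> K" "b \<in> K"
  shows "f b = Comp G (transport (h \<circ> linepath a b)) (f a)"
  using primitive_transport[OF primitive_linepath[OF assms(2,1,4,5)]
      continuous_into_linepath[OF X assms(2-5)]]
  by (simp add: linepath_0' linepath_1')

lemma transport_const:
  assumes "x \<in> points X"
  shows "transport (\<lambda>_. x) = Ident G (obj x)"
proof -
  note id = Ident_laws[OF obj_in_Obj[OF assms]]
  have "primitive {0..1::real} (\<lambda>_. x) (obj x) (\<lambda>_. Ident G (obj x))"
    unfolding primitive_def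
  proof (intro conjI exI[of _ 1] ballI impI)
    fix p q :: real
    show "Ident G (obj x) = Comp G (segment ((\<lambda>_. x) \<circ> linepath p q)) (Ident G (obj x))"
      using id arrow_laws(2)[OF id(1)] segment_const[OF assms] by (simp add: comp_def)
  qed (simp_all add: id)
  then show ?thesis by (rule transport_eq) simp
qed

text \<open>A single primitive along the joined path, evaluated at 0, 1/2 and 1, yields both
  factors.\<close>

lemma transport_join:
  assumes "continuous_into {0..1} X \<gamma>" "continuous_into {0..1} X \<rho>" "\<gamma> 1 = \<rho> 0"
  shows "transport (join_paths \<gamma> \<rho>) = Comp G (transport \<rho>) (transport \<gamma>)"
proof -
  let ?h = "join_paths \<gamma> \<rho>"
  note h = continuous_into_join[OF X assms]
  obtain f where f: "primitive {0..1} ?h (obj (?h 0)) f" "f 0 = Ident G (obj (?h 0))"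
    using normalized_primitive_exists[OF compact_Icc _ _ h] by auto
  note edge = primitive_linepath_transport[OF f(1) _ h]
  have "transport (?h \<circ> linepath 0 (1/2)) = transport \<gamma>"
    by (rule transport_cong[symmetric, OF _ assms(1)]) (auto simp: join_paths_def linepath_def)
  moreover have "transport (?h \<circ> linepath (1/2) 1) = transport \<rho>"
  proof (rule transport_cong[symmetric, OF _ assms(2)])
    fix t :: real assume "t \<in> {0..1}"
    have mid: "linepath (1/2) 1 t = (1 + t) / 2" by (simp add: linepath_def field_simps)
    \<comment> \<open>The case \<open>t = 0\<close> is separate because the midpoint 1/2 belongs to
      the first branch of \<open>join_paths\<close>; there \<open>\<gamma> 1 = \<rho> 0\<close> is
      used.\<close>
    show "\<rho> t = (?h \<circ> linepath (1/2) 1) t"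
      unfolding comp_def mid using assms(3) \<open>t \<in> {0..1}\<close> by (cases "t = 0") (auto simp: join_paths_def add_divide_distrib)
  qed
  ultimately have "f 1 = Comp G (transport \<rho>) (Comp G (transport \<gamma>) (f 0))"
    using edge[of 0 "1/2"] edge[of "1/2" 1] by simp
  moreover have "Comp G (transport \<gamma>) (f 0) = transport \<gamma>"
    using arrow_laws(1)[OF transport_arrow(1)[OF assms(1)]] transport_arrow(2)[OF assms(1)] f(2)
    by simp
  ultimately show ?thesis using transport_eq[OF f] by simp
qed

text \<open>Take a primitive on the square that is the identity at the corner (0,0). The corner
  (1,1) is reached along \<open>\<gamma>\<close> and then a constant edge, or along a constant edge
  and then \<open>\<gamma>'\<close>. Constant edges contribute identities, so the value at (1,1) is
  the transport along either path.\<close>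

lemma transport_homotopic:
  assumes "path_homotopic X \<gamma> \<gamma>'"
  shows "transport \<gamma> = transport \<gamma>'"
proof -
  note D = path_homotopicD[OF assms X]
  obtain h :: "real \<times> real \<Rightarrow> 'a" where h: "continuous_into ({0..1} \<times> {0..1}) X h"
    "\<And>t. t \<in> {0..1} \<Longrightarrow> h (0, t) = \<gamma> t" "\<And>t. t \<in> {0..1} \<Longrightarrow> h (1, t) = \<gamma>' t"
    "\<And>s. s \<in> {0..1} \<Longrightarrow> h (s, 0) = \<gamma> 0" "\<And>s. s \<in> {0..1} \<Longrightarrow> h (s, 1) = \<gamma> 1"
    using assms unfolding path_homotopic_def by blast
  let ?Q = "{0..1} \<times> {0..1} :: (real \<times> real) set"
  have Q: "convex ?Q" "compact ?Q" "0 \<in> ?Q" by (auto intro: convex_Times compact_Times simp: zero_prod_def)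
  obtain f where f: "primitive ?Q h (obj (h 0)) f" "f 0 = Ident G (obj (h 0))"
    by (rule normalized_primitive_exists[OF Q(2,1,3) h(1)])
  have pts: "\<gamma> 0 \<in> points X" "\<gamma> 1 \<in> points X" using D(1) by (auto intro: continuous_into_points)
  note const = transport_const[OF pts(1)] transport_const[OF pts(2)]
    and contc = continuous_into_const[OF X pts(1)] continuous_into_const[OF X pts(2)]
  have arr: "f p \<in> Arr G" "Dom G (f p) = obj (h 0)" "Cod G (f p) = obj (h p)" if "p \<in> ?Q" for p
    using f(1) that unfolding primitive_def by blast+
  have edge: "f b = Comp G (transport \<rho>) (f a)"
    if "a \<in> ?Q" "b \<in> ?Q" "\<And>t. t \<in> {0..1} \<Longrightarrow> h (linepath a b t) = \<rho> t" for a b \<rho>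
    using primitive_linepath_transport[OF f(1) Q(1) h(1) that(1,2)]
      transport_cong[OF _ continuous_into_linepath[OF X Q(1) h(1) that(1,2)], of \<rho>] that(3) by simp
  have lp: "linepath (a, b) (c, d) t = (linepath a c t, linepath b d t)" for a b c d t :: real
    by (simp add: linepath_def)
  have lp01: "linepath 0 1 t = t" "linepath a a t = a" for a t :: real
    by (simp_all add: linepath_def algebra_simps)
  have h0: "h 0 = \<gamma> 0" using h(2)[of 0] by (simp add: zero_prod_def)
  have "f (0, 1) = Comp G (transport \<gamma>) (f (0, 0))"
    by (rule edge) (auto simp: lp lp01 h(2))
  moreover have "f (1, 0) = Comp G (transport (\<lambda>_. \<gamma> 0)) (f (0, 0))"
    by (rule edge) (auto simp: lp lp01 h(4))
  moreover have "f (1, 1) = Comp G (transport (\<lambda>_. \<gamma> 1)) (f (0, 1))"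
    by (rule edge) (auto simp: lp lp01 h(5))
  moreover have "f (1, 1) = Comp G (transport \<gamma>') (f (1, 0))"
    by (rule edge) (auto simp: lp lp01 h(3))
  moreover have "Comp G (transport (\<lambda>_. \<gamma> 0)) (f (0, 0)) = f (0, 0)"
    using arrow_laws(2)[OF arr(1), of "(0, 0)"] arr(3)[of "(0, 0)"] h(2)[of 0] const(1) by simp
  moreover have "Comp G (transport (\<lambda>_. \<gamma> 1)) (f (0, 1)) = f (0, 1)"
    using arrow_laws(2)[OF arr(1), of "(0, 1)"] arr(3)[of "(0, 1)"] h(2)[of 1] const(2) by simp
  moreover have "Comp G (transport \<gamma>) (f (0, 0)) = transport \<gamma>"
    "Comp G (transport \<gamma>') (f (0, 0)) = transport \<gamma>'"
    using arrow_laws(1)[OF transport_arrow(1)[OF D(1)]] transport_arrow(2)[OF D(1)]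
      arrow_laws(1)[OF transport_arrow(1)[OF D(2)]] transport_arrow(2)[OF D(2)] f(2) D(3) h0
    by (simp_all add: zero_prod_def)
  ultimately show ?thesis by simp
qed

text \<open>The reason is that the values of \<open>F\<close> on the initial pieces of
  \<open>\<gamma>\<close> form a normalized primitive. The lemma serves both halves of the universal
  property: with \<open>Y\<close> a member and \<open>F\<close> its cocone functor it shows that the
  mediating functor extends the cocone, and with \<open>Y = X\<close> and \<open>F\<close> any
  functor extending the cocone it gives uniqueness.\<close>

lemma functor_eq_transport:
  assumes Y: "limit_space Y" "preserves_convergence Y X (\<lambda>x. x)"
    and F: "is_functor (fundamental_groupoid Y) G F" "\<And>y. y \<in> points Y \<Longrightarrow> on_obj F y = obj y"
    and \<gamma>: "continuous_into {0..1} Y \<gamma>"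
    and \<delta>: "\<delta> > 0" "\<And>p q. \<lbrakk>p \<in> {0..1}; q \<in> {0..1}; dist p q < \<delta>\<rbrakk> \<Longrightarrow>
      on_arr F (homotopy_class Y (\<gamma> \<circ> linepath p q)) = segment (\<gamma> \<circ> linepath p q)"
  shows "on_arr F (homotopy_class Y \<gamma>) = transport \<gamma>"
proof -
  define f where "f = (\<lambda>t::real. on_arr F (homotopy_class Y (\<gamma> \<circ> linepath 0 t)))"
  have line: "continuous_into {0..1} Y (\<gamma> \<circ> linepath p q)" if "p \<in> {0..1}" "q \<in> {0..1}" for p q
    by (rule continuous_into_linepath[OF Y(1) _ \<gamma> that]) simp
  note props = homotopy_class_in_Arr[OF Y(1)] Dom_homotopy_class[OF Y(1)] Cod_homotopy_class[OF Y(1)]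
    continuous_into_points[OF \<gamma>] linepath_0' linepath_1'
  have F': "\<And>c. c \<in> Arr (fundamental_groupoid Y) \<Longrightarrow> on_arr F c \<in> Arr G \<and>
      Dom G (on_arr F c) = on_obj F (Dom (fundamental_groupoid Y) c) \<and>
      Cod G (on_arr F c) = on_obj F (Cod (fundamental_groupoid Y) c)"
    "\<And>y. y \<in> points Y \<Longrightarrow> on_arr F (Ident (fundamental_groupoid Y) y) = Ident G (on_obj F y)"
    "\<And>c d. \<lbrakk>c \<in> Arr (fundamental_groupoid Y); d \<in> Arr (fundamental_groupoid Y);
      Dom (fundamental_groupoid Y) d = Cod (fundamental_groupoid Y) c\<rbrakk> \<Longrightarrow>
      on_arr F (Comp (fundamental_groupoid Y) d c) = Comp G (on_arr F d) (on_arr F c)"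
    using F(1) by (auto simp: is_functor_def)
  have "primitive {0..1} \<gamma> (obj (\<gamma> 0)) f"
    unfolding primitive_def
  proof (intro conjI exI[of _ \<delta>] ballI impI)
    fix p q :: real assume p: "p \<in> {0..1}" and q: "q \<in> {0..1}" and pq: "dist p q < \<delta>"
    have "homotopy_class Y (\<gamma> \<circ> linepath 0 q) = Comp (fundamental_groupoid Y)
        (homotopy_class Y (\<gamma> \<circ> linepath p q)) (homotopy_class Y (\<gamma> \<circ> linepath 0 p))"
      by (rule homotopy_class_triangle[OF Y(1) _ \<gamma> _ p q]) auto
    then show "f q = Comp G (segment (\<gamma> \<circ> linepath p q)) (f p)"
      using line[OF p q] line[of 0 p] p F'(3) by (simp add: f_def props \<delta>(2)[OF p q pq, symmetric])
  next
    fix p :: real assume p: "p \<in> {0..1}"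
    then show "f p \<in> Arr G" "Dom G (f p) = obj (\<gamma> 0)" "Cod G (f p) = obj (\<gamma> p)"
      using F'(1)[OF props(1)[OF line[of 0 p]]] line[of 0 p] by (simp_all add: f_def props F(2))
  qed (fact \<delta>(1))
  moreover have "f 0 = Ident G (obj (\<gamma> 0))"
    using F'(2)[of "\<gamma> 0"] F(2)[of "\<gamma> 0"] continuous_into_points[OF \<gamma>, of 0]
    by (simp add: f_def comp_def linepath_refl Ident_fundamental_groupoid)
  ultimately have "transport \<gamma> = f 1" by (rule transport_eq)
  also have "homotopy_class Y (\<gamma> \<circ> linepath 0 1) = homotopy_class Y \<gamma>"
    by (simp add: linepath_def comp_def)
  then have "f 1 = on_arr F (homotopy_class Y \<gamma>)" by (simp add: f_def)
  finally show ?thesis by simp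
qed

section \<open>The mediating functor\<close>

definition mediating :: "('a, (real \<Rightarrow> 'a) set, 'q, 'r) functor_maps" where
  "mediating = \<lparr>on_obj = restrict obj (points X),
     on_arr = (\<lambda>c\<in>Arr (fundamental_groupoid X). transport (SOME \<gamma>. \<gamma> \<in> c))\<rparr>"

text \<open>Homotopy invariance of \<open>transport\<close> makes the value independent of the
  chosen representative.\<close>

lemma on_arr_mediating:
  assumes "continuous_into {0..1} X \<gamma>"
  shows "on_arr mediating (homotopy_class X \<gamma>) = transport \<gamma>"
proof -
  have "(SOME \<rho>. \<rho> \<in> homotopy_class X \<gamma>) \<in> homotopy_class X \<gamma>"
    by (rule someI[of "\<lambda>\<rho>. \<rho> \<in> homotopy_class X \<gamma>", OF restrict_mem_homotopy_class[OF X assms]])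
  then have "transport \<gamma> = transport (SOME \<rho>. \<rho> \<in> homotopy_class X \<gamma>)"
    by (intro transport_homotopic) (simp add: mem_homotopy_class[OF X])
  then show ?thesis
    using homotopy_class_in_Arr[OF X assms] by (simp add: mediating_def)
qed

lemma is_functor_mediating: "is_functor (fundamental_groupoid X) G mediating"
proof -
  note [simp] = on_arr_mediating Dom_homotopy_class[OF X] Cod_homotopy_class[OF X]
    Comp_homotopy_class[OF X] transport_arrow transport_join continuous_into_join[OF X]
  have obj: "on_obj mediating = restrict obj (points X)" by (simp add: mediating_def)
  have arr: "on_arr mediating c \<in> Arr G" if "c \<in> Arr (fundamental_groupoid X)" for c
    using that by (rule Arr_fundamental_groupoidE[OF X]) simp
  show ?thesis
    unfolding is_functor_def
  proof (intro conjI ballI impI)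
    show "on_obj mediating \<in> Obj (fundamental_groupoid X) \<rightarrow>\<^sub>E Obj G"
      by (auto simp: obj obj_in_Obj)
    show "on_arr mediating \<in> Arr (fundamental_groupoid X) \<rightarrow>\<^sub>E Arr G"
      using arr by (auto simp: PiE_def mediating_def)
  next
    fix x assume "x \<in> Obj (fundamental_groupoid X)"
    then show "on_arr mediating (Ident (fundamental_groupoid X) x) = Ident G (on_obj mediating x)"
      by (simp add: obj Ident_fundamental_groupoid continuous_into_const[OF X] transport_const)
  next
    fix c assume "c \<in> Arr (fundamental_groupoid X)"
    then obtain g where g: "continuous_into {0..1} X g" "c = homotopy_class X g"
      by (rule Arr_fundamental_groupoidE[OF X])
    then show "Dom G (on_arr mediating c) = on_obj mediating (Dom (fundamental_groupoid X) c)"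
      "Cod G (on_arr mediating c) = on_obj mediating (Cod (fundamental_groupoid X) c)"
      by (simp_all add: obj continuous_into_points[OF g(1)])
    fix d assume "d \<in> Arr (fundamental_groupoid X)"
    then obtain k where k: "continuous_into {0..1} X k" "d = homotopy_class X k"
      by (rule Arr_fundamental_groupoidE[OF X])
    assume "Dom (fundamental_groupoid X) d = Cod (fundamental_groupoid X) c"
    then show "on_arr mediating (Comp (fundamental_groupoid X) d c) =
        Comp G (on_arr mediating d) (on_arr mediating c)"
      using g k by simp
  qed
qed

lemma mediating_factors:
  assumes U: "U \<in> \<O>"
  shows "compose_functors (fundamental_groupoid (subspace_conv X U)) mediating
    (fundamental_groupoid_map (subspace_conv X U) X (\<lambda>x. x)) = \<psi> U"
proof -
  let ?Y = "subspace_conv X U"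
  note Y = member_limit_space[OF U] preserves_convergence_inclusion[OF member_subset[OF U]]
  have ext: "on_obj (\<psi> U) \<in> extensional U" "on_arr (\<psi> U) \<in> extensional (Arr (fundamental_groupoid ?Y))"
    using functor_\<psi>[OF U] by (auto simp: is_functor_def PiE_def)
  have "on_arr mediating (on_arr (fundamental_groupoid_map ?Y X (\<lambda>x. x)) c) = on_arr (\<psi> U) c"
    if c: "c \<in> Arr (fundamental_groupoid ?Y)" for c
  proof -
    obtain g where g: "continuous_into {0..1} ?Y g" "c = homotopy_class ?Y g"
      using c by (rule Arr_fundamental_groupoidE[OF Y(1)])
    have gX: "continuous_into {0..1} X g" "g \<in> {0..1} \<rightarrow> U"
      using g(1) by (auto simp: continuous_into_subspace_conv member_subset[OF U])
    have "on_arr (\<psi> U) (homotopy_class ?Y g) = transport g"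
    \<comment> \<open>Every subpath of \<open>g\<close> stays in \<open>U\<close>, so any positive
      modulus will do; it is taken to be 1.\<close>
    proof (rule functor_eq_transport[OF Y functor_\<psi>[OF U] _ g(1) zero_less_one])
      show "on_obj (\<psi> U) y = obj y" if "y \<in> points ?Y" for y using that by (simp add: obj_eq[OF U])
      fix p q :: real assume pq: "p \<in> {0..1}" "q \<in> {0..1}"
      have "g \<circ> linepath p q \<in> {0..1} \<rightarrow> U"
        using linepath_mem[of "{0..1}", OF _ pq] gX(2) by auto
      then show "on_arr (\<psi> U) (homotopy_class ?Y (g \<circ> linepath p q)) = segment (g \<circ> linepath p q)"
        using continuous_into_linepath[OF X _ gX(1) pq] by (simp add: segment_eq[OF U])
    qed
    moreover have "on_arr (fundamental_groupoid_map ?Y X (\<lambda>x. x)) c = homotopy_class X g"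
      using on_arr_fundamental_groupoid_map[OF Y(1) X Y(2) g(1)] g(2) by (simp add: comp_def)
    ultimately show ?thesis using g(2) by (simp add: on_arr_mediating[OF gX(1)])
  qed
  then have "compose (Arr (fundamental_groupoid ?Y)) (on_arr mediating)
      (on_arr (fundamental_groupoid_map ?Y X (\<lambda>x. x))) = on_arr (\<psi> U)"
    by (intro extensionalityI[OF compose_extensional ext(2)]) (simp add: compose_eq)
  moreover have "compose U (on_obj mediating) (restrict (\<lambda>x. x) U) = on_obj (\<psi> U)"
    using member_subset[OF U] by (intro extensionalityI[OF compose_extensional ext(1)])
      (auto simp: compose_eq mediating_def obj_eq[OF U])
  ultimately show ?thesis
    by (intro functor_maps.equality) (simp_all add: compose_functors_def)
qed

text \<open>By the factorization, \<open>F\<close> agrees with \<open>segment\<close> on every path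
  inside a member. Subpaths of \<open>\<gamma>\<close> over intervals shorter than a Lebesgue number
  are of this kind, so \<open>functor_eq_transport\<close> determines \<open>F\<close> on all
  arrows.\<close>

lemma mediating_unique:
  assumes F: "is_functor (fundamental_groupoid X) G F"
    and factors: "\<And>U. U \<in> \<O> \<Longrightarrow> compose_functors (fundamental_groupoid (subspace_conv X U)) F
      (fundamental_groupoid_map (subspace_conv X U) X (\<lambda>x. x)) = \<psi> U"
  shows "F = mediating"
proof -
  have obj: "on_obj F x = obj x" if x: "x \<in> points X" for x
  proof -
    obtain U where U: "U \<in> \<O>" "x \<in> U" by (rule point_in_member[OF x])
    have "on_obj (\<psi> U) x = on_obj F x"
      using U(2) by (subst factors[OF U(1), symmetric]) (simp add: compose_functors_def compose_eq)
    then show ?thesis by (simp add: obj_eq[OF U])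
  qed
  have seg: "on_arr F (homotopy_class X f) = segment f"
    if U: "U \<in> \<O>" and f: "continuous_into {0..1} X f" "f \<in> {0..1} \<rightarrow> U" for U f
  proof -
    have "on_arr (fundamental_groupoid_map (subspace_conv X U) X (\<lambda>x. x))
        (homotopy_class (subspace_conv X U) f) = homotopy_class X f"
      using on_arr_fundamental_groupoid_map[OF member_limit_space[OF U] X
          preserves_convergence_inclusion[OF member_subset[OF U]] continuous_into_member[OF U f]]
      by (simp add: comp_def)
    then have "on_arr (\<psi> U) (homotopy_class (subspace_conv X U) f) = on_arr F (homotopy_class X f)"
      using homotopy_class_member[OF U f]
      by (subst factors[OF U, symmetric]) (simp add: compose_functors_def compose_eq)
    then show ?thesis by (simp add: segment_eq[OF U f])
  qed
  have arr: "on_arr F (homotopy_class X \<gamma>) = transport \<gamma>" if \<gamma>: "continuous_into {0..1} X \<gamma>" for \<gamma>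
  proof -
    obtain \<epsilon> where "\<epsilon> > 0" and \<epsilon>: "\<And>p. p \<in> {0..1} \<Longrightarrow> \<exists>U\<in>\<O>. \<gamma> \<in> {0..1} \<inter> ball p \<epsilon> \<rightarrow> U"
      using Lebesgue_number_members[OF compact_Icc \<gamma>] by blast
    show ?thesis
    proof (rule functor_eq_transport[OF X _ F obj \<gamma> \<open>\<epsilon> > 0\<close>])
      show "preserves_convergence X X (\<lambda>x. x)"
        by (simp add: preserves_convergence_def filtermap_ident)
      fix p q :: real assume p: "p \<in> {0..1}" and q: "q \<in> {0..1}" and pq: "dist p q < \<epsilon>"
      obtain U where U: "U \<in> \<O>" "\<gamma> \<in> {0..1} \<inter> ball p \<epsilon> \<rightarrow> U" using \<epsilon>[OF p] by blast
      have "linepath p q \<in> {0..1} \<rightarrow> {0..1} \<inter> ball p \<epsilon>"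
        using p q pq \<open>\<epsilon> > 0\<close> by (intro linepath_mem convex_Int) auto
      then have "\<gamma> \<circ> linepath p q \<in> {0..1} \<rightarrow> U" using U(2) by auto
      then show "on_arr F (homotopy_class X (\<gamma> \<circ> linepath p q)) = segment (\<gamma> \<circ> linepath p q)"
        using continuous_into_linepath[OF X _ \<gamma> p q] by (intro seg[OF U(1)]) auto
    qed
  qed
  have ext: "on_obj F \<in> extensional (points X)" "on_arr F \<in> extensional (Arr (fundamental_groupoid X))"
    using F by (auto simp: is_functor_def PiE_def)
  have "on_obj F = on_obj mediating"
    by (rule extensionalityI[OF ext(1)]) (auto simp: mediating_def obj)
  moreover have "on_arr F = on_arr mediating"
  proof (rule extensionalityI[OF ext(2)])
    show "on_arr mediating \<in> extensional (Arr (fundamental_groupoid X))"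
      by (simp add: mediating_def)
    fix c assume "c \<in> Arr (fundamental_groupoid X)"
    then show "on_arr F c = on_arr mediating c"
      by (rule Arr_fundamental_groupoidE[OF X]) (simp add: arr on_arr_mediating)
  qed
  ultimately show ?thesis by (intro functor_maps.equality) auto
qed

end


section \<open>The colimit theorem\<close>

lemma inclusion_category_simps [simp]:
  "Obj (inclusion_category \<O>) = \<O>"
  "Arr (inclusion_category \<O>) = {(U, V). U \<in> \<O> \<and> V \<in> \<O> \<and> U \<subseteq> V}"
  "Dom (inclusion_category \<O>) = fst" "Cod (inclusion_category \<O>) = snd"
  "Ident (inclusion_category \<O>) U = (U, U)"
  "Comp (inclusion_category \<O>) (V, W) (U, V') = (U, W)"
  by (simp_all add: inclusion_category_def)

lemma category_inclusion_category: "category (inclusion_category \<O>)"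
  unfolding category_def by auto

lemma groupoid_diagram_fundamental_groupoid:
  assumes "limit_space X" "\<And>U. U \<in> \<O> \<Longrightarrow> U \<subseteq> points X"
  shows "groupoid_diagram (inclusion_category \<O>)
      (\<lambda>U. fundamental_groupoid (subspace_conv X U))
      (\<lambda>(U, V). fundamental_groupoid_map (subspace_conv X U) (subspace_conv X V) (\<lambda>x. x))"
proof -
  have U: "limit_space (subspace_conv X U)" if "U \<in> \<O>" for U
    using limit_space_subspace_conv[OF assms(1)] assms(2) that by blast
  show ?thesis
    unfolding groupoid_diagram_def
    using fundamental_groupoid_map_compose[OF U U U preserves_convergence_subspace_conv
        preserves_convergence_subspace_conv]
    by (auto simp: category_inclusion_category U groupoid_fundamental_groupoid
        fundamental_groupoid_map_ident
        intro!: is_functor_fundamental_groupoid_map preserves_convergence_subspace_conv)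
qed

text \<open>The cocone identity for \<open>U \<subseteq> V\<close> is functoriality applied to the
  inclusion of \<open>U\<close> in X, factored through \<open>V\<close>.\<close>

lemma groupoid_cocone_fundamental_groupoid:
  assumes "limit_space X" "\<And>U. U \<in> \<O> \<Longrightarrow> U \<subseteq> points X"
  shows "groupoid_cocone (inclusion_category \<O>)
      (\<lambda>U. fundamental_groupoid (subspace_conv X U))
      (\<lambda>(U, V). fundamental_groupoid_map (subspace_conv X U) (subspace_conv X V) (\<lambda>x. x))
      (fundamental_groupoid X)
      (\<lambda>U. fundamental_groupoid_map (subspace_conv X U) X (\<lambda>x. x))"
proof -
  have U: "limit_space (subspace_conv X U)" if "U \<in> \<O>" for U
    using limit_space_subspace_conv[OF assms(1)] assms(2) that by blast
  show ?thesis
    unfolding groupoid_cocone_def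
    using fundamental_groupoid_map_compose[OF U U assms(1) preserves_convergence_subspace_conv
        preserves_convergence_inclusion[OF assms(2)], symmetric]
    by (auto simp: U assms(1) groupoid_fundamental_groupoid intro: subsetD[OF assms(2)]
        intro!: is_functor_fundamental_groupoid_map preserves_convergence_inclusion)
qed

theorem theorem4p2:
  fixes X :: "'a convergence_space" and \<O> :: "'a set set"
  assumes "limit_space X"
    and "convergence_system X \<O>"
    and "closed_under_finite_intersections \<O>"
  shows "groupoid_diagram (inclusion_category \<O>)
      (\<lambda>U. fundamental_groupoid (subspace_conv X U))
      (\<lambda>(U, V). fundamental_groupoid_map (subspace_conv X U) (subspace_conv X V) (\<lambda>x. x)) \<and>
    groupoid_colimit TYPE('q \<times> 'r) (inclusion_category \<O>)
      (\<lambda>U. fundamental_groupoid (subspace_conv X U))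
      (\<lambda>(U, V). fundamental_groupoid_map (subspace_conv X U) (subspace_conv X V) (\<lambda>x. x))
      (fundamental_groupoid X)
      (\<lambda>U. fundamental_groupoid_map (subspace_conv X U) X (\<lambda>x. x))"
proof -
  let ?J = "inclusion_category \<O>" and ?D = "\<lambda>U. fundamental_groupoid (subspace_conv X U)"
    and ?T = "\<lambda>(U, V). fundamental_groupoid_map (subspace_conv X U) (subspace_conv X V) (\<lambda>x. x)"
    and ?\<phi> = "\<lambda>U. fundamental_groupoid_map (subspace_conv X U) X (\<lambda>x. x)"
  have sub: "U \<subseteq> points X" if "U \<in> \<O>" for U
    using assms(2) that by (simp add: convergence_system_def)
  have "\<exists>!F. is_functor (fundamental_groupoid X) G F \<and>
      (\<forall>U\<in>Obj ?J. compose_functors (?D U) F (?\<phi> U) = \<psi> U)"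
    if cocone: "groupoid_cocone ?J ?D ?T G \<psi>"
    for G :: "('q, 'r) cat" and \<psi>
  proof -
    interpret fundamental_cocone X \<O> G \<psi>
    proof
      show "category G" using cocone by (simp add: groupoid_cocone_def groupoid_def)
      show "is_functor (?D U) G (\<psi> U)" if "U \<in> \<O>" for U
        using cocone that by (simp add: groupoid_cocone_def)
      show "compose_functors (?D U) (\<psi> V)
          (fundamental_groupoid_map (subspace_conv X U) (subspace_conv X V) (\<lambda>x. x)) = \<psi> U"
        if "U \<in> \<O>" "V \<in> \<O>" "U \<subseteq> V" for U V
        using conjunct2[OF conjunct2[OF cocone[unfolded groupoid_cocone_def]],
            THEN bspec, of "(U, V)"] that by simp
    qed (fact assms)+
    show ?thesis
    proof (rule ex1I[of _ mediating])
      show "is_functor (fundamental_groupoid X) G mediating \<and>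
          (\<forall>U\<in>Obj ?J. compose_functors (?D U) mediating (?\<phi> U) = \<psi> U)"
        using is_functor_mediating mediating_factors by simp
      fix F assume "is_functor (fundamental_groupoid X) G F \<and>
          (\<forall>U\<in>Obj ?J. compose_functors (?D U) F (?\<phi> U) = \<psi> U)"
      then show "F = mediating" by (intro mediating_unique) simp_all
    qed
  qed
  then show ?thesis
    unfolding groupoid_colimit_def
    using groupoid_diagram_fundamental_groupoid[OF assms(1) sub]
      groupoid_cocone_fundamental_groupoid[OF assms(1) sub] by blast
qed

end
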